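(* For each $n$ let $\mathbf{x}^n$ be a configuration of $n$ points in the square $[0,\sqrt n]^2$. Let $L_n>0$ satisfy $L_n=o(\sqrt{\log n})$ as $n\to\infty$. Suppose either (a) $\mathbf{x}^n$ is $L_n$-equidistributed as the uniform distribution on the square $[0,\sqrt n]^2$ of area $n$; or (more generally) (b) for some fixed $\rho>0$ and $\varepsilon>0$, there is for each $n$ a subcollection $\mathbf{y}^{k(n)}\subseteq\mathbf{x}^n$ of $k(n)$ points, all lying in a disk $D_n$ of area $\pi\rho n$, such that $k(n)>\pi\rho n\varepsilon$, and such that $\mathbf{y}^{k(n)}$ is $L_n$-equidistributed as the uniform distribution on $D_n$. For each $n$ let $G(\mathbf{x}^n)$ be a network based on the full collection of $n$ points $\mathbf{x}^n$. If $\operatorname{len}(G(\mathbf{x}^n))/n$ remains bounded as $n\to\infty$, then $$\operatorname{excess}(G(\mathbf{x}^n))=\Omega(\sqrt{\log n}),$$ that is, $\liminf_{n\to\infty}\operatorname{excess}(G(\mathbf{x}^n))/\sqrt{\log n}>0$.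
   Context: A network $G(\mathbf{x}^n)$ on a configuration of points $\mathbf{x}^n=\{x_1,\dots,x_n\}$ in the plane is the configuration together with a finite collection of straight line segments in the plane which combine to connect every $x_i$ to every other $x_j$; the network may involve other junction points (routes may change from one segment to another wherever segments meet). $\operatorname{len}(G(\mathbf{x}^n))$ is the total length of the network. $\ell(x_i,x_j)$ is the length of the shortest path within the network between $x_i$ and $x_j$, and $|x_i-x_j|$ is Euclidean distance. The excess route length is $$\operatorname{excess}(G(\mathbf{x}^n))=\operatorname{average}_{(i,j)}\bigl(\ell(x_i,x_j)-|x_i-x_j|\bigr),$$ where the average is over all distinct pairs $(i,j)$, $i\ne j$. Equidistribution: let $\mathbf{z}^n$ (for varying $n$) be a sequence of finite configurations in the plane, $\mu^n$ probability measures on the plane, and $L_n>0$. Then $\mathbf{z}^n$ is said to be $L_n$-equidistributed as $\mu^n$ if, for each $n$, there is a coupling of random variables $(X_n,Y_n)$ such that $X_n$ has the uniform distribution on the finite point-set $\mathbf{z}^n$, $Y_n$ has distribution $\mu^n$, and $$\mathbb{E}\left[\min\left(1,\frac{|X_n-Y_n|}{L_n}\right)\right]\to 0\qquad\text{as } n\to\infty .$$ *)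

theory Defs
  imports "HOL-Probability.Probability" "HOL-Library.Landau_Symbols"
begin

type_synonym plane = "real ^ 2"

(* A network is given by its finite collection of segments; (a, b) stands for the closed
   segment with end points a and b. *)
type_synonym segments = "(plane \<times> plane) set"

(* The vertices of a route are its end points and the places where it changes from one
   segment to another; the leg between two consecutive vertices runs along a single segment. *)
definition route :: "segments \<Rightarrow> plane \<Rightarrow> plane \<Rightarrow> plane list \<Rightarrow> bool" where
  "route G p q vs \<longleftrightarrow>
     vs \<noteq> [] \<and> hd vs = p \<and> last vs = q \<and>
     successively (\<lambda>u v. \<exists>(a, b)\<in>G. u \<in> closed_segment a b \<and> v \<in> closed_segment a b) vs"

definition route_length :: "plane list \<Rightarrow> real" where
  "route_length vs = sum_list (map2 dist vs (tl vs))"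

definition network :: "plane set \<Rightarrow> segments \<Rightarrow> bool" where
  "network X G \<longleftrightarrow> finite G \<and> (\<forall>p\<in>X. \<forall>q\<in>X. p \<noteq> q \<longrightarrow> (\<exists>vs. route G p q vs))"

(* Overlapping parts of distinct segments are counted separately; every network can be described
   by non-overlapping segments, and then this is the length of their union. *)
definition network_length :: "segments \<Rightarrow> real" where
  "network_length G = (\<Sum>(a, b)\<in>G. dist a b)"

definition network_dist :: "segments \<Rightarrow> plane \<Rightarrow> plane \<Rightarrow> real" where
  "network_dist G p q = Inf {route_length vs | vs. route G p q vs}"

definition distinct_pairs :: "'a set \<Rightarrow> ('a \<times> 'a) set" where
  "distinct_pairs X = {(p, q). p \<in> X \<and> q \<in> X \<and> p \<noteq> q}"

definition excess :: "plane set \<Rightarrow> segments \<Rightarrow> real" where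
  "excess X G =
     (\<Sum>(p, q)\<in>distinct_pairs X. network_dist G p q - dist p q) / real (card (distinct_pairs X))"

(* As a measure on the Borel sets of the plane; used for finite nonempty Z only. *)
definition uniform_on_points :: "plane set \<Rightarrow> plane measure" where
  "uniform_on_points Z = distr (uniform_count_measure Z) borel (\<lambda>z. z)"

definition uniform_on_region :: "plane set \<Rightarrow> plane measure" where
  "uniform_on_region A = uniform_measure lborel A"

(* A coupling of random variables (X, Y) is represented by its joint law on plane \<times> plane. *)
definition coupling :: "plane measure \<Rightarrow> plane measure \<Rightarrow> (plane \<times> plane) measure \<Rightarrow> bool" where
  "coupling \<mu>1 \<mu>2 \<nu> \<longleftrightarrow>
     prob_space \<nu> \<and> sets \<nu> = sets (borel \<Otimes>\<^sub>M borel) \<and>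
     distr \<nu> borel fst = \<mu>1 \<and> distr \<nu> borel snd = \<mu>2"

(* Sequences are indexed by n \<ge> 1; their value at 0 is irrelevant. *)
definition equidistributed ::
  "(nat \<Rightarrow> real) \<Rightarrow> (nat \<Rightarrow> plane set) \<Rightarrow> (nat \<Rightarrow> plane measure) \<Rightarrow> bool" where
  "equidistributed L Z \<mu> \<longleftrightarrow>
     (\<exists>\<nu>. (\<forall>n\<ge>1. coupling (uniform_on_points (Z n)) (\<mu> n) (\<nu> n)) \<and>
          (\<lambda>n. \<integral>w. min 1 (dist (fst w) (snd w) / L n) \<partial>\<nu> n) \<longlonglongrightarrow> 0)"

definition square :: "real \<Rightarrow> plane set" where
  "square s = {p. \<forall>i. 0 \<le> p $ i \<and> p $ i \<le> s}"

definition disk_of_area :: "real \<Rightarrow> plane set \<Rightarrow> bool" where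
  "disk_of_area A D \<longleftrightarrow> (\<exists>c r. r > 0 \<and> D = cball c r \<and> measure lborel D = A)"

end

theory Submission
  imports Defs "HOL-Real_Asymp.Real_Asymp"
begin

text \<open>
Fix two random points of the configuration and suppose that the route between them has excess at most \<open>E\<close>.
At distance \<open>t\<close> from its start the route is then within order \<open>sqrt (E t)\<close> of the straight line. As the
line is in general position and the network has bounded length per unit area, the window of that
width typically contains no piece of the network whose angle with the line is below a small constant
times \<open>1 / sqrt (E t)\<close>. So the route runs at such an angle or a larger one and wastes at least of order \<open>1 / (E t)\<close> per unit
of progress. Integrated over \<open>t\<close> from one power of \<open>n\<close> to another, this is of order \<open>ln n / E\<close>.
The waste is at most of order \<open>E\<close>, hence \<open>E\<^sup>2\<close> is at least of order \<open>ln n\<close>.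

To make this rigorous, \<open>t\<close> is split into dyadic scales \<open>T = 2^k\<close>. A piece of the network that is
close to the line and nearly parallel to it is called aligned. For a single pair of points, the lemma
\<open>all_scales\<close> compares the sum over the scales with the waste of the route plus the weighted length
of the aligned pieces. The mean of that length is bounded in \<open>nn_integral_aligned_length_le\<close>: with
a point of the network fixed, both ends of an aligned line are confined to thin rectangles, and
the product of their areas does not involve \<open>E\<close>.

The general position of the line comes from the coupling. The ends of the line are not the points of the
configuration but the uniform points coupled to them. These are at distance at most \<open>L\<close> with high
probability, and \<open>L\<close> is smaller than \<open>E\<close> when \<open>E\<close> is of order \<open>sqrt (ln n)\<close>, so joining them to the route changes the
excess by a constant factor only. The lemma \<open>scale_count_bound\<close> puts these parts together for one configuration: the number
of scales is at most a constant times \<open>E\<^sup>2\<close>.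
\<close>

section \<open>Frames and rectangles in the plane\<close>

definition perp :: "plane \<Rightarrow> plane" where
  "perp v = vector [- (v $ 2), v $ 1]"

lemma perp_simps [simp]: "perp v $ 1 = - (v $ 2)" "perp v $ 2 = v $ 1"
  by (simp_all add: perp_def)

lemma inner_plane: "(x::plane) \<bullet> y = x $ 1 * y $ 1 + x $ 2 * y $ 2"
  by (simp add: inner_vec_def sum_2)

lemma norm_plane_sq: "(norm (x::plane))\<^sup>2 = (x $ 1)\<^sup>2 + (x $ 2)\<^sup>2"
  unfolding power2_norm_eq_inner by (simp add: inner_plane power2_eq_square)

lemma norm_sq_frame:
  assumes "norm v = 1"
  shows "(norm x)\<^sup>2 = (x \<bullet> v)\<^sup>2 + (x \<bullet> perp v)\<^sup>2"
proof -
  have "(v $ 1)\<^sup>2 + (v $ 2)\<^sup>2 = 1" using assms norm_plane_sq[of v] by simp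
  then show ?thesis unfolding norm_plane_sq inner_plane perp_simps by algebra
qed

lemma inner_frame:
  assumes "norm u = 1"
  shows "x \<bullet> y = (x \<bullet> u) * (y \<bullet> u) + (x \<bullet> perp u) * (y \<bullet> perp u)"
proof -
  have "(u $ 1)\<^sup>2 + (u $ 2)\<^sup>2 = 1" using assms norm_plane_sq[of u] by simp
  then show ?thesis unfolding inner_plane perp_simps by algebra
qed

lemma norm_perp [simp]: "norm (perp v) = norm v"
proof -
  have "(norm (perp v))\<^sup>2 = (norm v)\<^sup>2" unfolding norm_plane_sq by simp
  then show ?thesis by simp
qed

definition rectangle :: "plane \<Rightarrow> real \<Rightarrow> real \<Rightarrow> plane set" where
  "rectangle v A B = {y. \<bar>y \<bullet> v\<bar> \<le> A \<and> \<bar>y \<bullet> perp v\<bar> \<le> B}"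

lemma rectangle_closed: "closed (rectangle v A B)"
  unfolding rectangle_def
  by (intro closed_Collect_conj closed_Collect_le continuous_intros)

text \<open>The rectangle is the image of an axis-parallel one under the rotation with columns \<open>v\<close> and
\<open>perp v\<close>, which has determinant 1.\<close>

lemma emeasure_rectangle:
  assumes v: "norm v = 1" and A: "0 \<le> A" and B: "0 \<le> B"
  shows "emeasure lborel (rectangle v A B) = ennreal (4 * A * B)"
proof -
  define f :: "plane \<Rightarrow> plane" where "f x = x $ 1 *\<^sub>R v + x $ 2 *\<^sub>R perp v" for x
  define Q :: "plane set" where "Q = cbox (vector [-A, -B]) (vector [A, B])"
  have v1: "(v $ 1)\<^sup>2 + (v $ 2)\<^sup>2 = 1" using v norm_plane_sq[of v] by simp
  have lin: "linear f"
    by (rule linearI) (auto simp: f_def algebra_simps vec_eq_iff)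
  have fv: "f x \<bullet> v = x $ 1" "f x \<bullet> perp v = x $ 2" for x
    using v1 unfolding f_def inner_plane by (simp_all add: algebra_simps) algebra+
  have ff: "f (vector [y \<bullet> v, y \<bullet> perp v]) = y" for y
  proof -
    have "y \<bullet> v * v $ 1 + (y \<bullet> perp v) * (- v $ 2) = y $ 1"
      "y \<bullet> v * v $ 2 + (y \<bullet> perp v) * (v $ 1) = y $ 2"
      using v1 unfolding inner_plane perp_simps by algebra+
    then show ?thesis by (simp add: f_def vec_eq_iff forall_2)
  qed
  have im: "rectangle v A B = f ` Q"
  proof (intro set_eqI iffI)
    fix y assume "y \<in> rectangle v A B"
    then have "vector [y \<bullet> v, y \<bullet> perp v] \<in> Q"
      by (auto simp: rectangle_def Q_def mem_box_cart forall_2 abs_le_iff)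
    then show "y \<in> f ` Q" using ff by (metis image_eqI)
  next
    fix y assume "y \<in> f ` Q"
    then show "y \<in> rectangle v A B"
      by (auto simp: rectangle_def Q_def mem_box_cart forall_2 abs_le_iff fv)
  qed
  have det: "\<bar>det (matrix f)\<bar> = 1"
    using v1 by (simp add: det_2 matrix_def f_def axis_def power2_eq_square)
  have "0 \<in> Q" unfolding Q_def using A B by (simp add: mem_box_cart forall_2)
  then have "Q \<noteq> {}" by auto
  then have mQ: "measure lebesgue Q = 4 * A * B"
    unfolding Q_def using A B by (simp add: content_cbox_if_cart UNIV_2)
  have "measure lebesgue (rectangle v A B) = 4 * A * B"
    unfolding im using measure_linear_image[OF lin, of Q] det mQ by (simp add: Q_def)
  moreover have "rectangle v A B \<in> lmeasurable"
    unfolding im by (rule measurable_linear_image[OF lin]) (simp add: Q_def)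
  ultimately have "emeasure lebesgue (rectangle v A B) = ennreal (4 * A * B)"
    by (simp add: emeasure_eq_measure2)
  moreover have "rectangle v A B \<in> sets lborel"
    using rectangle_closed by (simp add: borel_closed)
  ultimately show ?thesis by simp
qed

section \<open>Lines aligned with a piece of the network\<close>

text \<open>The configurations in which the network can help the traveller from \<open>y\<close> to \<open>z\<close>: a point \<open>w\<close> of the
network, on a segment of direction \<open>v\<close>, lies at distance between \<open>T\<close> and \<open>2 T\<close> along the ray from \<open>y\<close>
to \<open>z\<close>, is so close to that ray that a route through \<open>w\<close> need not waste more than about \<open>E\<close>, and
the segment makes an angle with the ray whose cosine exceeds \<open>1 - a\<close> up to sign. The constant 5 is
the excess \<open>E\<close> of a route plus four detours of length at most \<open>E\<close> at its ends.\<close>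

definition aligned :: "real \<Rightarrow> real \<Rightarrow> real \<Rightarrow> plane \<Rightarrow> plane \<Rightarrow> plane \<Rightarrow> plane \<Rightarrow> bool" where
  "aligned E a T v w y z \<longleftrightarrow>
     T < (w - y) \<bullet> sgn (z - y) \<and> (w - y) \<bullet> sgn (z - y) \<le> 2 * T \<and>
     norm (w - y) \<le> (w - y) \<bullet> sgn (z - y) + 5 * E \<and> 1 - a < \<bar>v \<bullet> sgn (z - y)\<bar>"

text \<open>Put \<open>q = w - y\<close> and let \<open>u\<close> be the direction from \<open>y\<close> to \<open>z\<close>. Writing \<open>q\<close> in the frame of \<open>u\<close>, its
lateral part is at most \<open>6 sqrt (E T)\<close> by Pythagoras, and \<open>u\<close> deviates from \<open>v\<close> by an angle of order
\<open>\<kappa> / sqrt (E T)\<close>. Turning to the frame of \<open>v\<close> adds a lateral error of order \<open>T / sqrt (E T)\<close>,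
which is again at most of order \<open>sqrt (E T)\<close> since \<open>E \<ge> 1\<close>. Hence for a fixed point \<open>w\<close> and direction
\<open>v\<close> both \<open>y\<close> and \<open>z\<close> are confined to thin rectangles along \<open>v\<close>; the product of their widths is of order
\<open>\<kappa> R\<close>, in which \<open>E\<close> and \<open>T\<close> have cancelled.\<close>

lemma aligned_geometry:
  assumes v: "norm v = 1" and E: "1 \<le> E" and T: "5 * E \<le> 2 * T"
    and \<kappa>: "0 < \<kappa>" "\<kappa> \<le> 1" and a: "a = \<kappa>\<^sup>2 / (E * T)"
    and al: "aligned E a T v w y z" and D: "norm (z - y) \<le> 2 * R"
  shows "y - w \<in> rectangle v (4 * T) (9 * sqrt (E * T))"
    and "z - y \<in> rectangle v (2 * R) (2 * R * (3 / 2 * \<kappa> / sqrt (E * T)))"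
proof -
  define u where "u = sgn (z - y)"
  define q where "q = w - y"
  define t where "t = q \<bullet> u"
  define s where "s = sqrt (E * T)"
  have T0: "T \<ge> 5/2" "T > 0" using E T by linarith+
  have ET: "1 \<le> E * T" using mult_mono[of 1 E 1 T] E T0 by simp
  have s2: "s\<^sup>2 = E * T" and s1: "1 \<le> s" using ET by (auto simp: s_def)
  have t: "T < t" "t \<le> 2 * T" "norm q \<le> t + 5 * E" "1 - a < \<bar>v \<bullet> u\<bar>"
    using al by (auto simp: aligned_def u_def q_def t_def)
  have "u \<noteq> 0" using t T0 by (auto simp: t_def)
  then have zy: "z - y \<noteq> 0" and u: "norm u = 1" by (auto simp: u_def norm_sgn)
  have a01: "0 < a" "a \<le> 1"
    using \<kappa> ET unfolding a by (auto simp: field_simps power_le_one intro: order.trans[of _ 1])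
  have uv: "(u \<bullet> perp v)\<^sup>2 \<le> 2 * a"
  proof -
    have "(1 - a)\<^sup>2 \<le> \<bar>v \<bullet> u\<bar>\<^sup>2" using t(4) a01 by (intro power_mono) auto
    moreover have "1 = (u \<bullet> v)\<^sup>2 + (u \<bullet> perp v)\<^sup>2" using norm_sq_frame[OF v, of u] u by simp
    moreover have "(1 - a)\<^sup>2 = 1 - 2 * a + a\<^sup>2" by algebra
    moreover have "(v \<bullet> u)\<^sup>2 = (u \<bullet> v)\<^sup>2" by (simp add: inner_commute)
    ultimately show ?thesis using zero_le_power2[of a] unfolding power2_abs by linarith
  qed
  define b where "b = 3 / 2 * \<kappa> / s"
  have b2: "2 * a \<le> b\<^sup>2" and b0: "0 < b"
    using \<kappa> s1 s2 ET unfolding a b_def by (auto simp: power_divide power_mult_distrib field_simps)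
  have uvb: "\<bar>u \<bullet> perp v\<bar> \<le> b"
    using uv b2 b0 by (metis abs_le_square_iff abs_of_pos order.trans)
  \<comment> \<open>The ellipse with small excess: (norm q)^2 - t^2 is at most 5 E (2 t + 5 E).\<close>
  have h: "\<bar>q \<bullet> perp u\<bar> \<le> 6 * s"
  proof -
    have "(q \<bullet> perp u)\<^sup>2 = (norm q)\<^sup>2 - t\<^sup>2" using norm_sq_frame[OF u, of q] by (simp add: t_def)
    also have "\<dots> \<le> (t + 5 * E)\<^sup>2 - t\<^sup>2" using t(3) by (intro diff_right_mono power_mono) auto
    also have "\<dots> = 5 * E * (2 * t + 5 * E)" by algebra
    also have "\<dots> \<le> 5 * E * (6 * T)" using t T E by (intro mult_left_mono) auto
    also have "\<dots> \<le> (6 * s)\<^sup>2" unfolding power_mult_distrib s2 using ET by simp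
    finally show ?thesis using s1 by (metis abs_le_square_iff abs_of_nonneg zero_le_mult_iff zero_le_numeral zero_le_one order.trans)
  qed
  \<comment> \<open>This is T <= E T, the place where E >= 1 absorbs the rotation from the frame of u to that of
      v.\<close>
  have TE: "T * (1 / s) \<le> s"
    using s1 s2 E T0 by (simp add: field_simps power2_eq_square)
  have tb: "t * b \<le> 3 * s"
  proof -
    have "t * b \<le> (2 * T) * (3 / 2 * (1 / s))"
      using t T0 \<kappa> s1 b0 unfolding b_def by (intro mult_mono) (auto simp: field_simps)
    then show ?thesis using TE by simp
  qed
  have pp: "\<bar>perp u \<bullet> perp v\<bar> \<le> 1"
    using Cauchy_Schwarz_ineq2[of "perp u" "perp v"] u v by simp
  have "q \<bullet> perp v = t * (u \<bullet> perp v) + (q \<bullet> perp u) * (perp u \<bullet> perp v)"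
    using inner_frame[OF u, of q "perp v"] by (simp add: t_def inner_commute)
  then have "\<bar>q \<bullet> perp v\<bar> \<le> t * \<bar>u \<bullet> perp v\<bar> + \<bar>q \<bullet> perp u\<bar> * \<bar>perp u \<bullet> perp v\<bar>"
    using t T0 by (metis abs_mult abs_of_pos abs_triangle_ineq less_trans)
  also have "\<dots> \<le> t * b + (6 * s) * 1"
    using uvb h pp t T0 s1 by (intro add_mono mult_mono) auto
  also have "\<dots> \<le> 9 * s" using tb by simp
  finally have lat: "\<bar>q \<bullet> perp v\<bar> \<le> 9 * s" .
  have "\<bar>q \<bullet> v\<bar> \<le> 4 * T"
    using Cauchy_Schwarz_ineq2[of q v] v t T by simp
  moreover have "(y - w) \<bullet> x = - (q \<bullet> x)" for x by (simp add: q_def algebra_simps)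
  ultimately show "y - w \<in> rectangle v (4 * T) (9 * sqrt (E * T))"
    using lat by (auto simp: rectangle_def s_def)
  have zu: "z - y = norm (z - y) *\<^sub>R u" using zy by (simp add: u_def sgn_div_norm)
  have "\<bar>(z - y) \<bullet> perp v\<bar> = norm (z - y) * \<bar>u \<bullet> perp v\<bar>"
    by (subst zu) (simp add: abs_mult)
  also have "\<dots> \<le> 2 * R * b" using D uvb order.trans[OF norm_ge_zero D] by (intro mult_mono) auto
  finally have "\<bar>(z - y) \<bullet> perp v\<bar> \<le> 2 * R * b" .
  moreover have "\<bar>(z - y) \<bullet> v\<bar> \<le> 2 * R"
    using Cauchy_Schwarz_ineq2[of "z - y" v] v D by simp
  ultimately show "z - y \<in> rectangle v (2 * R) (2 * R * (3 / 2 * \<kappa> / sqrt (E * T)))"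
    by (auto simp: rectangle_def s_def b_def)
qed

lemma emeasure_translated_rectangle:
  assumes "norm v = 1" "0 \<le> A" "0 \<le> B"
  shows "emeasure lborel {y. y - w \<in> rectangle v A B} = ennreal (4 * A * B)"
    and "{y. y - w \<in> rectangle v A B} \<in> sets lborel"
proof -
  have "{y. y - w \<in> rectangle v A B} = (\<lambda>y. - w + y) -` rectangle v A B \<inter> space lborel" by auto
  moreover have "(\<lambda>y. - w + y) \<in> lborel \<rightarrow>\<^sub>M borel" by simp
  moreover have "rectangle v A B \<in> sets borel" using rectangle_closed by (rule borel_closed)
  ultimately show "{y. y - w \<in> rectangle v A B} \<in> sets lborel" 
    and "emeasure lborel {y. y - w \<in> rectangle v A B} = ennreal (4 * A * B)"
    by (metis measurable_sets, metis emeasure_distr emeasure_rectangle[OF assms] lborel_distr_plus)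
qed

lemma aligned_measurable [measurable (raw)]:
  fixes w y z :: "'c \<Rightarrow> plane"
  assumes [measurable]: "w \<in> borel_measurable M" "y \<in> borel_measurable M" "z \<in> borel_measurable M"
  shows "Measurable.pred M (\<lambda>x. aligned E a T v (w x) (y x) (z x))"
  unfolding aligned_def sgn_div_norm by measurable

text \<open>The probability that two independent uniform points of a region \<open>D\<close> of area \<open>V\<close> are aligned with a
given network point and direction: the areas \<open>144 T sqrt (E T)\<close> and \<open>24 \<kappa> R\<^sup>2 / sqrt (E T)\<close> of the two
rectangles of the preceding geometry are multiplied and divided by \<open>V\<^sup>2\<close>.\<close>

lemma nn_integral_aligned_le:
  assumes v: "norm v = 1" and E: "1 \<le> E" and T: "5 * E \<le> 2 * T"
    and \<kappa>: "0 < \<kappa>" "\<kappa> \<le> 1" and a: "a = \<kappa>\<^sup>2 / (E * T)"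
    and D: "D \<in> sets borel" "D \<subseteq> cball c R" and V: "emeasure lborel D = ennreal V" "0 < V"
  shows "(\<integral>\<^sup>+ y. \<integral>\<^sup>+ z. of_bool (aligned E a T v w y z) \<partial>uniform_on_region D \<partial>uniform_on_region D)
    \<le> ennreal (3456 * \<kappa> * T * R\<^sup>2 / V\<^sup>2)"
proof -
  define b where "b = 3 / 2 * \<kappa> / sqrt (E * T)"
  define Q1 where "Q1 = {y. y - w \<in> rectangle v (4 * T) (9 * sqrt (E * T))}"
  define Q2 where "Q2 y = {z. z - y \<in> rectangle v (2 * R) (2 * R * b)}" for y
  have "D \<noteq> {}" using V by auto
  then have "cball c R \<noteq> {}" using D by auto
  then have R: "0 \<le> R" by simp
  have T0: "T > 0" and ET: "E * T > 0" and b0: "0 \<le> b" using E T \<kappa> by (auto simp: b_def)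
  have q1: "emeasure lborel Q1 = ennreal (144 * T * sqrt (E * T))" "Q1 \<in> sets lborel"
    unfolding Q1_def using emeasure_translated_rectangle[OF v, of "4 * T" "9 * sqrt (E * T)" w] T0 ET
    by (simp_all add: mult_ac)
  have q2: "emeasure lborel (Q2 y) = ennreal (16 * R\<^sup>2 * b)" "Q2 y \<in> sets lborel" for y
    unfolding Q2_def using emeasure_translated_rectangle[OF v, of "2 * R" "2 * R * b" y] R b0
    by (simp_all add: power2_eq_square mult_ac)
  have pt: "of_bool (aligned E a T v w y z) * indicator D z \<le> indicator Q1 y * (indicator (Q2 y) z :: ennreal)"
    if "y \<in> D" for y z
  proof (cases "z \<in> D \<and> aligned E a T v w y z")
    case True
    have "dist c z \<le> R" "dist c y \<le> R" using that True D(2) by auto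
    then have "norm (z - y) \<le> 2 * R"
      using dist_triangle[of z y c] by (simp add: dist_norm[symmetric] dist_commute)
    from aligned_geometry[OF v E T \<kappa> a _ this] True
    show ?thesis by (auto simp: Q1_def Q2_def b_def)
  qed auto
  have inner: "(\<integral>\<^sup>+ z. of_bool (aligned E a T v w y z) \<partial>uniform_on_region D)
     \<le> ennreal (16 * R\<^sup>2 * b / V) * indicator Q1 y" if "y \<in> D" for y
  proof -
    have "(\<integral>\<^sup>+ z. of_bool (aligned E a T v w y z) \<partial>uniform_on_region D)
      = (\<integral>\<^sup>+ z. of_bool (aligned E a T v w y z) * indicator D z \<partial>lborel) / ennreal V"
      unfolding uniform_on_region_def using D by (subst nn_integral_uniform_measure) (auto simp: V)
    also have "\<dots> \<le> (\<integral>\<^sup>+ z. indicator Q1 y * indicator (Q2 y) z \<partial>lborel) / ennreal V"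
      using pt[OF that] by (intro divide_right_mono_ennreal nn_integral_mono) auto
    also have "\<dots> = indicator Q1 y * ennreal (16 * R\<^sup>2 * b) / ennreal V"
      using q2 by (subst nn_integral_cmult_indicator) auto
    also have "\<dots> = ennreal (16 * R\<^sup>2 * b / V) * indicator Q1 y"
      using V(2) b0 by (auto simp: indicator_def divide_ennreal)
    finally show ?thesis .
  qed
  have "(\<integral>\<^sup>+ y. \<integral>\<^sup>+ z. of_bool (aligned E a T v w y z) \<partial>uniform_on_region D \<partial>uniform_on_region D)
    = (\<integral>\<^sup>+ y. (\<integral>\<^sup>+ z. of_bool (aligned E a T v w y z) \<partial>uniform_on_region D) * indicator D y \<partial>lborel) / ennreal V"
    (is "?I = _")
  proof -
    have "sigma_finite_measure (uniform_on_region D)"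
      unfolding uniform_on_region_def
      by (intro prob_space_imp_sigma_finite prob_space_uniform_measure) (use V in auto)
    then interpret sigma_finite_measure "uniform_on_region D" .
    have [measurable_cong]: "sets (uniform_on_region D) = sets borel"
      by (simp add: uniform_on_region_def)
    have "(\<lambda>y. \<integral>\<^sup>+ z. of_bool (aligned E a T v w y z) \<partial>uniform_on_region D) \<in> borel_measurable lborel"
      by measurable
    then show ?thesis
      using D by (subst (1) uniform_on_region_def, subst nn_integral_uniform_measure) (auto simp: V)
  qed
  also have "\<dots> \<le> (\<integral>\<^sup>+ y. ennreal (16 * R\<^sup>2 * b / V) * indicator Q1 y \<partial>lborel) / ennreal V"
  proof (intro divide_right_mono_ennreal nn_integral_mono)
    fix y
    show "(\<integral>\<^sup>+ z. of_bool (aligned E a T v w y z) \<partial>uniform_on_region D) * indicator D y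
      \<le> ennreal (16 * R\<^sup>2 * b / V) * indicator Q1 y"
      using inner[of y] by (cases "y \<in> D") simp_all
  qed
  also have "\<dots> = ennreal (16 * R\<^sup>2 * b / V) * ennreal (144 * T * sqrt (E * T)) / ennreal V"
    using q1 by (subst nn_integral_cmult_indicator) auto
  also have "\<dots> = ennreal (16 * R\<^sup>2 * b / V * (144 * T * sqrt (E * T)) / V)"
    using V(2) b0 T0 ET by (subst ennreal_mult[symmetric]) (auto simp: divide_ennreal)
  also have "16 * R\<^sup>2 * b / V * (144 * T * sqrt (E * T)) / V = 3456 * \<kappa> * T * R\<^sup>2 / V\<^sup>2"
  proof -
    have "sqrt (E * T) \<noteq> 0" using ET by auto
    then show ?thesis unfolding b_def power2_eq_square using V(2) by (simp add: field_simps)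
  qed
  finally show ?thesis .
qed

section \<open>Routes of small excess\<close>

lemma route_vertices:
  assumes "route G p q vs"
  obtains f N where "f 0 = p" "f N = q"
    "\<And>i. i < N \<Longrightarrow> \<exists>(a, b)\<in>G. f i \<in> closed_segment a b \<and> f (Suc i) \<in> closed_segment a b"
    "route_length vs = (\<Sum>i<N. dist (f i) (f (Suc i)))"
proof (rule that[of "(!) vs" "length vs - 1"])
  note r = assms[unfolded route_def]
  show "vs ! 0 = p" "vs ! (length vs - 1) = q"
    using r by (auto simp: hd_conv_nth last_conv_nth)
  show "\<exists>(a, b)\<in>G. vs ! i \<in> closed_segment a b \<and> vs ! Suc i \<in> closed_segment a b"
    if "i < length vs - 1" for i
    using r that by (auto simp: successively_conv_nth)
  show "route_length vs = (\<Sum>i<length vs - 1. dist (vs ! i) (vs ! Suc i))"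
    using r unfolding route_length_def
    by (cases vs) (auto simp: sum_list_sum_nth nth_tl lessThan_atLeast0 min_def intro!: sum.cong)
qed

lemma dist_le_sum_legs:
  fixes f :: "nat \<Rightarrow> 'a::metric_space"
  assumes "i \<le> j"
  shows "dist (f i) (f j) \<le> (\<Sum>m\<in>{i..<j}. dist (f m) (f (Suc m)))"
  using assms
proof (induction j rule: dec_induct)
  case (step j)
  then show ?case using dist_triangle[of "f i" "f (Suc j)" "f j"] by simp
qed simp

lemma dist_le_route_length:
  assumes "route G p q vs"
  shows "dist p q \<le> route_length vs"
proof -
  obtain f N where f: "f 0 = p" "f N = q" "route_length vs = (\<Sum>i<N. dist (f i) (f (Suc i)))"
    using route_vertices[OF assms] by metis
  show ?thesis using dist_le_sum_legs[of 0 N f] f by (simp add: lessThan_atLeast0)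
qed

text \<open>Applied to the progress of a route along a fixed direction, this selects for each level a leg that
crosses it forwards, so the backward and repeated pieces of a route can be ignored.\<close>

lemma upcrossing:
  fixes h :: "nat \<Rightarrow> real"
  assumes "h 0 < t" "t \<le> h N"
  obtains i where "i < N" "h i < t" "t \<le> h (Suc i)"
proof -
  have "\<exists>i<N. h i < t \<and> t \<le> h (Suc i)" using assms(2)
  proof (induction N)
    case 0 then show ?case using assms(1) by simp
  next
    case (Suc N) then show ?case by (cases "t \<le> h N") (auto intro: less_SucI)
  qed
  then show ?thesis using that by blast
qed

lemma emeasure_affine_preimage:
  fixes T :: "real set"
  assumes T: "T \<in> sets borel" and m: "m \<noteq> 0"
  shows "emeasure lborel {t. (t - c) / m \<in> T} = ennreal \<bar>m\<bar> * emeasure lborel T"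
    and "{t. (t - c) / m \<in> T} \<in> sets borel"
proof -
  show S: "{t. (t - c) / m \<in> T} \<in> sets borel"
    using T by measurable
  have "emeasure lborel {t. (t - c) / m \<in> T} = (\<integral>\<^sup>+t. indicator {t. (t - c) / m \<in> T} t \<partial>lborel)"
    using S by simp
  also have "\<dots> = ennreal \<bar>m\<bar> * (\<integral>\<^sup>+t. indicator {t. (t - c) / m \<in> T} (c + m * t) \<partial>lborel)"
    using S m by (intro nn_integral_real_affine) auto
  also have "(\<lambda>t. indicator {t. (t - c) / m \<in> T} (c + m * t) :: ennreal) = indicator T"
    using m by (auto simp: indicator_def)
  finally show "emeasure lborel {t. (t - c) / m \<in> T} = ennreal \<bar>m\<bar> * emeasure lborel T"
    using T by simp
qed

text \<open>For a segment \<open>s\<close> this is the proportion of its points aligned with the pair \<open>y\<close>, \<open>z\<close>. Its product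
with the length of \<open>s\<close>, unlike the mere existence of an aligned point, has a mean of at most a constant
times that length, so arbitrarily many short segments do no harm. For a degenerate segment \<open>sgn 0 = 0\<close> takes the place of the
direction; its weight in \<open>aligned_length\<close> is its length 0.\<close>

definition aligned_fraction :: "real \<Rightarrow> real \<Rightarrow> real \<Rightarrow> plane \<times> plane \<Rightarrow> plane \<Rightarrow> plane \<Rightarrow> real" where
  "aligned_fraction E a T s y z = measure lborel
     {\<tau> \<in> {0..1}. aligned E a T (sgn (snd s - fst s)) (fst s + \<tau> *\<^sub>R (snd s - fst s)) y z}"

definition aligned_length :: "real \<Rightarrow> real \<Rightarrow> real \<Rightarrow> segments \<Rightarrow> plane \<Rightarrow> plane \<Rightarrow> real" where
  "aligned_length E a T G y z = (\<Sum>s\<in>G. dist (fst s) (snd s) * aligned_fraction E a T s y z)"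

text \<open>A route with vertices \<open>f 0\<close>, ..., \<open>f N\<close> that exceeds the distance of its ends by at most \<open>E\<close>, together with
points \<open>y\<close> and \<open>z\<close> within \<open>L\<close> of the ends. The line of sight runs from \<open>y\<close> to \<open>z\<close>, which will be the
uniform random points coupled to the two ends.\<close>

locale good_route =
  fixes f :: "nat \<Rightarrow> plane" and N :: nat and G :: segments and y z :: plane and E L :: real
  assumes finite_G: "finite G"
    and legs: "i < N \<Longrightarrow> \<exists>(p, q)\<in>G. f i \<in> closed_segment p q \<and> f (Suc i) \<in> closed_segment p q"
    and start: "dist (f 0) y \<le> L" and finish: "dist (f N) z \<le> L" and LE: "L \<le> E" and E1: "1 \<le> E"
    and len: "(\<Sum>i<N. dist (f i) (f (Suc i))) \<le> dist (f 0) (f N) + E"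
    and yz: "y \<noteq> z"
begin

definition direction where "direction = sgn (z - y)"
definition progress where "progress w = (w - y) \<bullet> direction"
text \<open>The cosine of the angle between a leg and the line of sight is \<open>1 - slope\<close>, so a leg of length \<open>d\<close> wastes
\<open>slope * d\<close>. Its shadow is the set of levels of progress that it crosses forwards, empty for a
backward leg.\<close>

definition leg where "leg i = f (Suc i) - f i"
definition slope where "slope i = 1 - sgn (leg i) \<bullet> direction"
definition shadow where "shadow i = {progress (f i) <.. progress (f (Suc i))}"

lemma norm_direction: "norm direction = 1" using yz by (simp add: direction_def norm_sgn)

lemma inner_direction_le: "x \<bullet> direction \<le> norm x"
  using Cauchy_Schwarz_ineq2[of x direction] norm_direction by simp

lemma progress_z: "progress z = dist y z"
proof -
  have "(z - y) \<bullet> (z - y) = norm (z - y) * norm (z - y)"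
    by (simp add: dot_square_norm power2_eq_square)
  then have "progress z = norm (z - y)"
    using yz unfolding progress_def direction_def sgn_div_norm inner_scaleR_right by simp
  then show ?thesis by (simp add: dist_norm norm_minus_commute)
qed

lemma slope_nonneg: "0 \<le> slope i"
  using inner_direction_le[of "sgn (leg i)"] by (auto simp: slope_def norm_sgn split: if_splits)

lemma dist_ends: "dist (f 0) (f N) \<le> dist y z + 2 * L"
  using start finish dist_triangle[of "f 0" "f N" y] dist_triangle[of y "f N" z] by (simp add: dist_commute)

lemma progress_start: "progress (f 0) \<le> L"
  using inner_direction_le[of "f 0 - y"] start by (simp add: progress_def dist_norm)

lemma progress_finish: "dist y z - L \<le> progress (f N)"
proof -
  have "progress z - progress (f N) = (z - f N) \<bullet> direction" by (simp add: progress_def algebra_simps)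
  also have "\<dots> \<le> L" using inner_direction_le[of "z - f N"] finish by (simp add: dist_norm norm_minus_commute)
  finally show ?thesis using progress_z by simp
qed

text \<open>The waste of all legs is the length of the route minus its progress, and the progress is at least
\<open>dist y z - 2 L\<close>.\<close>

lemma sum_slope_le: "(\<Sum>i<N. slope i * dist (f i) (f (Suc i))) \<le> 5 * E"
proof -
  have "slope i * dist (f i) (f (Suc i)) = dist (f i) (f (Suc i)) - (progress (f (Suc i)) - progress (f i))" for i
  proof -
    have "norm (leg i) * (sgn (leg i) \<bullet> direction) = leg i \<bullet> direction"
      by (cases "leg i = 0") (simp_all add: sgn_div_norm)
    then show ?thesis
      by (simp add: slope_def progress_def dist_norm norm_minus_commute leg_def algebra_simps)
  qed
  then have "(\<Sum>i<N. slope i * dist (f i) (f (Suc i))) = (\<Sum>i<N. dist (f i) (f (Suc i))) - (progress (f N) - progress (f 0))"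
    by (simp only: sum_subtractf[of "\<lambda>i. dist (f i) (f (Suc i))"] sum_lessThan_telescope[of "\<lambda>i. progress (f i)"])
  then show ?thesis using len dist_ends progress_finish progress_start LE by linarith
qed

text \<open>Every point of the route lies in an ellipse with foci \<open>y\<close> and \<open>z\<close>: the detour through it costs at most
the excess \<open>E\<close> and four passages between an end of the route and its companion.\<close>

lemma near_ellipse:
  assumes i: "i < N" and w: "w \<in> closed_segment (f i) (f (Suc i))"
  shows "norm (w - y) \<le> progress w + 5 * E"
proof -
  have split: "(\<Sum>i<N. dist (f i) (f (Suc i))) =
     (\<Sum>m\<in>{0..<i}. dist (f m) (f (Suc m))) + dist (f i) (f (Suc i)) + (\<Sum>m\<in>{Suc i..<N}. dist (f m) (f (Suc m)))"
    using i by (simp add: lessThan_atLeast0 sum.atLeastLessThan_concat[of 0 i N, symmetric] sum.atLeast_Suc_lessThan[of i N])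
  have "dist (f i) (f (Suc i)) = dist (f i) w + dist w (f (Suc i))"
    using w by (simp add: between_mem_segment[symmetric] between)
  moreover have "dist w y \<le> dist w (f i) + dist (f i) (f 0) + dist (f 0) y"
    using dist_triangle[of w y "f i"] dist_triangle[of "f i" y "f 0"] by linarith
  moreover have "dist w z \<le> dist w (f (Suc i)) + dist (f (Suc i)) (f N) + dist (f N) z"
    using dist_triangle[of w z "f (Suc i)"] dist_triangle[of "f (Suc i)" z "f N"] by linarith
  moreover have "dist (f 0) (f i) \<le> (\<Sum>m\<in>{0..<i}. dist (f m) (f (Suc m)))"
    by (rule dist_le_sum_legs) simp
  moreover have "dist (f (Suc i)) (f N) \<le> (\<Sum>m\<in>{Suc i..<N}. dist (f m) (f (Suc m)))"
    using i by (intro dist_le_sum_legs) simp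
  ultimately have "dist w y + dist w z \<le> dist y z + 5 * E"
    using split len dist_ends start finish LE dist_commute[of "f 0" "f i"] dist_commute[of w "f i"] by linarith
  moreover have "dist y z - progress w \<le> dist w z"
  proof -
    have "progress z - progress w = (z - w) \<bullet> direction" by (simp add: progress_def algebra_simps)
    then show ?thesis using inner_direction_le[of "z - w"] progress_z by (simp add: dist_norm norm_minus_commute)
  qed
  ultimately show ?thesis by (simp add: dist_norm)
qed

text \<open>A forward crossing by a leg that wastes little is a crossing by a network segment that is nearly
parallel to the line of sight, and its point is near that line by the ellipse bound.\<close>

lemma aligned_at_steep_crossing:
  assumes i: "i < N" and a: "slope i < a" and t: "progress (f i) < t" "t \<le> progress (f (Suc i))" "T < t" "t \<le> 2 * T"
  obtains p q \<tau> where "(p, q) \<in> G" "\<tau> \<in> {0..1}" "progress (p + \<tau> *\<^sub>R (q - p)) = t"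
    "aligned E a T (sgn (q - p)) (p + \<tau> *\<^sub>R (q - p)) y z"
proof -
  obtain p q where pq: "(p, q) \<in> G" "f i \<in> closed_segment p q" "f (Suc i) \<in> closed_segment p q"
    using legs[OF i] by auto
  define r where "r = (t - progress (f i)) / (progress (f (Suc i)) - progress (f i))"
  define w where "w = f i + r *\<^sub>R leg i"
  have r: "0 \<le> r" "r \<le> 1" using t by (auto simp: r_def divide_simps)
  have "progress w = progress (f i) + r * (progress (f (Suc i)) - progress (f i))"
    by (simp add: progress_def w_def leg_def algebra_simps)
  then have pw: "progress w = t" using t by (simp add: r_def)
  have w: "w \<in> closed_segment (f i) (f (Suc i))"
    unfolding w_def leg_def closed_segment_def using r
    by (auto intro!: exI[of _ r] simp: algebra_simps)
  have "w \<in> closed_segment p q"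
    using w pq(2,3) closed_segment_subset[of "f i" "closed_segment p q" "f (Suc i)"] by auto
  then obtain \<tau> where \<tau>: "0 \<le> \<tau>" "\<tau> \<le> 1" "w = p + \<tau> *\<^sub>R (q - p)"
    by (auto simp: closed_segment_def algebra_simps)
  obtain c d where "f i = p + c *\<^sub>R (q - p)" "f (Suc i) = p + d *\<^sub>R (q - p)"
    using pq(2,3) by (auto simp: closed_segment_def algebra_simps)
  then have "leg i = (d - c) *\<^sub>R (q - p)" by (simp add: leg_def algebra_simps)
  then have "sgn (leg i) \<bullet> direction = sgn (d - c) * (sgn (q - p) \<bullet> direction)" by (simp add: sgn_scaleR)
  moreover have "sgn (d - c) * x \<le> \<bar>x\<bar>" for x :: real by (auto simp: sgn_if)
  ultimately have "sgn (leg i) \<bullet> direction \<le> \<bar>sgn (q - p) \<bullet> direction\<bar>" by simp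
  then have "1 - a < \<bar>sgn (q - p) \<bullet> direction\<bar>" using a by (simp add: slope_def)
  then have "aligned E a T (sgn (q - p)) w y z"
    using near_ellipse[OF i w] pw t by (simp add: aligned_def progress_def direction_def)
  then show ?thesis using that[OF pq(1), of \<tau>] \<tau> pw by auto
qed

lemma aligned_set_measurable: "{\<tau> \<in> {0..1}. aligned E a T v (p + \<tau> *\<^sub>R q) y z} \<in> sets borel"
  by measurable

text \<open>Between the levels \<open>T\<close> and \<open>2 T\<close> every level is crossed forwards by some leg. The levels crossed by legs
of slope at least \<open>a\<close> are paid for by the waste of those legs; all other levels are the progress of an
aligned point of the network, and the progress along a segment changes at most at unit speed, so they
have measure at most the aligned length. Measuring sets of levels instead of lengths along the route makes
it irrelevant how often the route uses a piece of the network.\<close>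

lemma one_scale:
  assumes a: "0 \<le> a" "a \<le> 1" and T: "E \<le> T" "2 * T + E \<le> dist y z"
  shows "a * T \<le> (\<Sum>i<N. slope i * measure lborel ({T<..2 * T} \<inter> shadow i)) + a * aligned_length E a T G y z"
proof -
  define A where "A = {i. i < N \<and> a \<le> slope i}"
  define P where "P g = {\<tau> \<in> {0..1}. aligned E a T (sgn (snd g - fst g)) (fst g + \<tau> *\<^sub>R (snd g - fst g)) y z}" for g
  define m where "m g = (snd g - fst g) \<bullet> direction" for g
  \<comment> \<open>Q g is the set of levels attained by the aligned points of g, an affine image of P g. The
      slope m g of that affine map must be excluded from being 0, since then the division would
      return 0.\<close>
  define Q where "Q g = {t. m g \<noteq> 0 \<and> (t - progress (fst g)) / m g \<in> P g}" for g
  define I where "I = {T<..2 * T}"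
  have T0: "0 \<le> T" using T E1 by simp
  have P: "P g \<in> sets borel" for g unfolding P_def by (rule aligned_set_measurable)
  have Pfin: "emeasure lborel (P g) = ennreal (aligned_fraction E a T g y z)" for g
  proof -
    have "emeasure lborel (P g) \<le> emeasure lborel {0..1::real}" by (rule emeasure_mono) (auto simp: P_def)
    then have "emeasure lborel (P g) \<noteq> \<infinity>" by (auto simp: top_unique)
    then show ?thesis by (simp add: emeasure_eq_ennreal_measure aligned_fraction_def P_def)
  qed
  have Q: "Q g \<in> sets borel" "emeasure lborel (Q g) = ennreal (\<bar>m g\<bar> * aligned_fraction E a T g y z)" for g
  proof -
    have "Q g \<in> sets borel \<and> emeasure lborel (Q g) = ennreal (\<bar>m g\<bar> * aligned_fraction E a T g y z)"
    proof (cases "m g = 0")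
      case False
      then have "Q g = {t. (t - progress (fst g)) / m g \<in> P g}" by (simp add: Q_def)
      then show ?thesis
        using emeasure_affine_preimage[OF P False, of "progress (fst g)" g] Pfin[of g]
        by (simp add: ennreal_mult aligned_fraction_def)
    qed (simp add: Q_def)
    then show "Q g \<in> sets borel" "emeasure lborel (Q g) = ennreal (\<bar>m g\<bar> * aligned_fraction E a T g y z)" by auto
  qed
  have cover: "I \<subseteq> (\<Union>i\<in>A. I \<inter> shadow i) \<union> (\<Union>g\<in>G. Q g)"
  proof
    fix t assume t: "t \<in> I"
    have "progress (f 0) < t" "t \<le> progress (f N)"
      using t T progress_start progress_finish LE by (auto simp: I_def)
    then obtain i where i: "i < N" "progress (f i) < t" "t \<le> progress (f (Suc i))"
      by (rule upcrossing[of "\<lambda>i. progress (f i)"]) auto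
    show "t \<in> (\<Union>i\<in>A. I \<inter> shadow i) \<union> (\<Union>g\<in>G. Q g)"
    proof (cases "a \<le> slope i")
      case True
      then show ?thesis using i t by (auto simp: A_def shadow_def)
    next
      case False
      then obtain p q \<tau> where pq: "(p, q) \<in> G" "\<tau> \<in> {0..1}" "progress (p + \<tau> *\<^sub>R (q - p)) = t"
        "aligned E a T (sgn (q - p)) (p + \<tau> *\<^sub>R (q - p)) y z"
        using aligned_at_steep_crossing[OF i(1), of a t T] i t by (auto simp: I_def)
      have "sgn (q - p) \<bullet> direction \<noteq> 0" using pq(4) a by (auto simp: aligned_def direction_def)
      then have "m (p, q) \<noteq> 0" by (auto simp: m_def sgn_div_norm)
      moreover have "t = progress p + \<tau> * m (p, q)" using pq(3) by (simp add: progress_def m_def algebra_simps)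
      ultimately have "t \<in> Q (p, q)" using pq(2,4) by (simp add: Q_def P_def)
      then show ?thesis using pq(1) by blast
    qed
  qed
  have fmI: "I \<inter> shadow i \<in> fmeasurable lborel" for i
  proof (rule fmeasurableI2[of "{T..2*T}"])
    show "I \<inter> shadow i \<in> sets lborel" by (simp add: I_def shadow_def)
    show "{T..2 * T} \<in> fmeasurable lborel"
      using T0 by (intro fmeasurableI) auto
  qed (auto simp: I_def)
  have fmQ: "Q g \<in> fmeasurable lborel" for g using Q by (intro fmeasurableI) auto
  have finA: "finite A" by (simp add: A_def)
  have "T = measure lborel I" using T0 by (simp add: I_def)
  also have "\<dots> \<le> measure lborel ((\<Union>i\<in>A. I \<inter> shadow i) \<union> (\<Union>g\<in>G. Q g))"
    by (intro measure_mono_fmeasurable[OF cover] fmeasurable.Un fmeasurable.finite_UN finA finite_G fmI fmQ)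
      (simp add: I_def)
  also have "\<dots> \<le> measure lborel (\<Union>i\<in>A. I \<inter> shadow i) + measure lborel (\<Union>g\<in>G. Q g)"
    by (intro measure_Un_le sets.finite_UN finA finite_G fmeasurableD[OF fmI] fmeasurableD[OF fmQ])
  also have "\<dots> \<le> (\<Sum>i\<in>A. measure lborel (I \<inter> shadow i)) + (\<Sum>g\<in>G. measure lborel (Q g))"
    by (intro add_mono measure_UNION_le finA finite_G fmeasurableD[OF fmI] fmeasurableD[OF fmQ])
  also have "(\<Sum>g\<in>G. measure lborel (Q g)) \<le> aligned_length E a T G y z"
    unfolding aligned_length_def
  proof (rule sum_mono)
    fix g
    have "\<bar>m g\<bar> \<le> dist (fst g) (snd g)"
      using Cauchy_Schwarz_ineq2[of "snd g - fst g" direction] norm_direction by (simp add: m_def dist_norm norm_minus_commute)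
    then have "\<bar>m g\<bar> * aligned_fraction E a T g y z \<le> dist (fst g) (snd g) * aligned_fraction E a T g y z"
      by (intro mult_right_mono) (auto simp: aligned_fraction_def)
    moreover have "measure lborel (Q g) = \<bar>m g\<bar> * aligned_fraction E a T g y z"
      using Q(2)[of g] by (simp add: measure_def aligned_fraction_def)
    ultimately show "measure lborel (Q g) \<le> dist (fst g) (snd g) * aligned_fraction E a T g y z" by simp
  qed
  finally have "a * T \<le> a * ((\<Sum>i\<in>A. measure lborel (I \<inter> shadow i)) + aligned_length E a T G y z)"
    using a by (intro mult_left_mono) auto
  also have "\<dots> = (\<Sum>i\<in>A. a * measure lborel (I \<inter> shadow i)) + a * aligned_length E a T G y z"
    by (simp add: distrib_left sum_distrib_left)
  also have "(\<Sum>i\<in>A. a * measure lborel (I \<inter> shadow i)) \<le> (\<Sum>i\<in>A. slope i * measure lborel (I \<inter> shadow i))"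
    by (intro sum_mono mult_right_mono) (auto simp: A_def)
  also have "\<dots> \<le> (\<Sum>i<N. slope i * measure lborel (I \<inter> shadow i))"
    using slope_nonneg by (intro sum_mono2) (auto simp: A_def)
  finally show ?thesis by (simp add: I_def)
qed

text \<open>The dyadic ranges of levels are disjoint, so each leg is charged only once.\<close>

lemma measure_dyadic_shadow_le:
  "(\<Sum>k\<in>{K..<M}. measure lborel ({2 ^ k<..2 * 2 ^ k} \<inter> shadow i)) \<le> dist (f i) (f (Suc i))"
proof -
  have disj: "disjoint_family_on (\<lambda>k. {2 ^ k<..2 * 2 ^ k :: real} \<inter> shadow i) {K..<M}"
  proof (unfold disjoint_family_on_def, intro ballI impI)
    have *: "({2 ^ k<..2 * 2 ^ k :: real} \<inter> S) \<inter> ({2 ^ l<..2 * 2 ^ l} \<inter> S) = {}" if "k < l" for k l :: nat and S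
    proof -
      have "(2::real) ^ Suc k \<le> 2 ^ l" using that by (intro power_increasing) auto
      then show ?thesis by auto
    qed
    fix k l :: nat assume "k \<noteq> l"
    then show "({2 ^ k<..2 * 2 ^ k :: real} \<inter> shadow i) \<inter> ({2 ^ l<..2 * 2 ^ l} \<inter> shadow i) = {}"
      using *[of k l "shadow i"] *[of l k "shadow i"] by (cases "k < l") auto
  qed
  have fin: "shadow i \<in> fmeasurable lborel"
    by (rule fmeasurableI2[of "{progress (f i)..progress (f (Suc i))}"]) (auto simp: shadow_def emeasure_lborel_Icc_eq intro!: fmeasurableI)
  have fin': "{2 ^ k<..2 * 2 ^ k} \<inter> shadow i \<in> fmeasurable lborel" for k :: nat
    by (rule fmeasurableI2[OF fin]) (auto simp: shadow_def)
  have "(\<Sum>k\<in>{K..<M}. measure lborel ({2 ^ k<..2 * 2 ^ k} \<inter> shadow i))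
      = measure lborel (\<Union>k\<in>{K..<M}. {2 ^ k<..2 * 2 ^ k} \<inter> shadow i)"
    using disj fin' by (intro measure_finite_Union[symmetric]) (auto simp: shadow_def fmeasurableD2)
  also have "\<dots> \<le> measure lborel (shadow i)"
    using fin fin' by (intro measure_mono_fmeasurable) auto
  also have "\<dots> \<le> max 0 (leg i \<bullet> direction)"
    by (auto simp: shadow_def progress_def leg_def algebra_simps max_def)
  also have "\<dots> \<le> dist (f i) (f (Suc i))"
    using inner_direction_le[of "leg i"] by (simp add: leg_def dist_norm norm_minus_commute)
  finally show ?thesis .
qed

text \<open>Summing over the dyadic scales: the left side will grow linearly with the number of scales, the waste is
paid only once.\<close>

lemma all_scales:
  assumes a: "\<And>k. k \<in> {K..<M} \<Longrightarrow> 0 \<le> a k \<and> a k \<le> 1" and K: "E \<le> 2 ^ K" "2 ^ M + E \<le> dist y z"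
  shows "(\<Sum>k\<in>{K..<M}. a k * 2 ^ k) \<le> 5 * E + (\<Sum>k\<in>{K..<M}. a k * aligned_length E (a k) (2 ^ k) G y z)"
proof -
  have "(\<Sum>k\<in>{K..<M}. a k * 2 ^ k) \<le> (\<Sum>k\<in>{K..<M}. 
     (\<Sum>i<N. slope i * measure lborel ({2 ^ k<..2 * 2 ^ k} \<inter> shadow i)) + a k * aligned_length E (a k) (2 ^ k) G y z)"
  proof (rule sum_mono)
    fix k assume k: "k \<in> {K..<M}"
    have "(2::real) ^ K \<le> 2 ^ k" "(2::real) ^ Suc k \<le> 2 ^ M" using k by (auto intro!: power_increasing simp del: power_Suc)
    then show "a k * 2 ^ k \<le> (\<Sum>i<N. slope i * measure lborel ({2 ^ k<..2 * 2 ^ k} \<inter> shadow i)) + a k * aligned_length E (a k) (2 ^ k) G y z"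
      using a[OF k] K by (intro one_scale) (auto intro: order.trans)
  qed
  also have "\<dots> = (\<Sum>i<N. slope i * (\<Sum>k\<in>{K..<M}. measure lborel ({2 ^ k<..2 * 2 ^ k} \<inter> shadow i)))
      + (\<Sum>k\<in>{K..<M}. a k * aligned_length E (a k) (2 ^ k) G y z)"
    unfolding sum.distrib sum_distrib_left by (subst sum.swap) simp
  also have "(\<Sum>i<N. slope i * (\<Sum>k\<in>{K..<M}. measure lborel ({2 ^ k<..2 * 2 ^ k} \<inter> shadow i)))
     \<le> (\<Sum>i<N. slope i * dist (f i) (f (Suc i)))"
    by (intro sum_mono mult_left_mono measure_dyadic_shadow_le slope_nonneg)
  also have "\<dots> \<le> 5 * E" by (rule sum_slope_le)
  finally show ?thesis by simp
qed

end

lemma network_dist_ge: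
  assumes "network X G" "p \<in> X" "q \<in> X" "p \<noteq> q"
  shows "dist p q \<le> network_dist G p q"
  unfolding network_dist_def
proof (rule cInf_greatest)
  show "{route_length vs |vs. route G p q vs} \<noteq> {}"
    using assms unfolding network_def by auto
qed (auto simp: dist_le_route_length)

lemma short_route:
  assumes "network X G" "p \<in> X" "q \<in> X" "p \<noteq> q" "network_dist G p q < c"
  obtains vs where "route G p q vs" "route_length vs < c"
proof -
  have "{route_length vs |vs. route G p q vs} \<noteq> {}"
    using assms unfolding network_def by auto
  from cInf_lessD[OF this] show ?thesis
    using assms(5) that unfolding network_dist_def by blast
qed

text \<open>The deterministic conclusion for two points \<open>p\<close>, \<open>q\<close> of the configuration and companions \<open>y\<close>, \<open>z\<close>. The
points \<open>p\<close> and \<open>q\<close> are distinct because their companions are more than \<open>2 L\<close> apart.\<close>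

lemma aligned_length_lower_bound:
  assumes net: "network Z G" and pq: "p \<in> Z" "q \<in> Z" "p \<noteq> q \<Longrightarrow> network_dist G p q - dist p q < E"
    and L: "dist p y \<le> L" "dist q z \<le> L" "L \<le> E" and E: "1 \<le> E"
    and a: "\<And>k. k \<in> {K..<M} \<Longrightarrow> 0 \<le> a k \<and> a k \<le> 1"
    and K: "E \<le> 2 ^ K" "2 ^ M + E \<le> dist y z" "2 * L < dist y z"
  shows "(\<Sum>k\<in>{K..<M}. a k * 2 ^ k) \<le> 5 * E + (\<Sum>k\<in>{K..<M}. a k * aligned_length E (a k) (2 ^ k) G y z)"
proof -
  have "p \<noteq> q"
    using L(1,2) K(3) dist_triangle[of y z p] by (auto simp: dist_commute)
  then obtain vs where vs: "route G p q vs" "route_length vs < dist p q + E"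
    using short_route[OF net pq(1,2), of "dist p q + E"] pq(3) by (auto simp: algebra_simps)
  obtain f N where f: "f 0 = p" "f N = q"
    "\<And>i. i < N \<Longrightarrow> \<exists>(a, b)\<in>G. f i \<in> closed_segment a b \<and> f (Suc i) \<in> closed_segment a b"
    "route_length vs = (\<Sum>i<N. dist (f i) (f (Suc i)))"
    by (rule route_vertices[OF vs(1)]) blast
  have "y \<noteq> z" using L(1,3) E K(2,3) order.trans[OF zero_le_dist L(1)] by auto
  then interpret good_route f N G y z E L
    using f vs L E net by unfold_locales (auto simp: network_def)
  show ?thesis by (rule all_scales[OF a K(1,2)])
qed

section \<open>The mean aligned length\<close>

lemma uniform_on_region_prob_space:
  assumes "emeasure lborel D = ennreal V" "0 < V"
  shows "prob_space (uniform_on_region D)"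
  unfolding uniform_on_region_def by (intro prob_space_uniform_measure) (use assms in auto)

lemma sets_uniform_on_region [measurable_cong, simp]: "sets (uniform_on_region D) = sets borel"
  by (simp add: uniform_on_region_def)

lemma aligned_length_nonneg: "0 \<le> aligned_length E a T G y z"
  unfolding aligned_length_def aligned_fraction_def by (intro sum_nonneg mult_nonneg_nonneg) auto

lemma ennreal_aligned_fraction:
  "ennreal (aligned_fraction E a T s y z) =
    (\<integral>\<^sup>+ \<tau>. indicator {0..1} \<tau> * of_bool (aligned E a T (sgn (snd s - fst s)) (fst s + \<tau> *\<^sub>R (snd s - fst s)) y z) \<partial>lborel)"
proof -
  define P where "P = {\<tau> \<in> {0..1}. aligned E a T (sgn (snd s - fst s)) (fst s + \<tau> *\<^sub>R (snd s - fst s)) y z}"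
  have P: "P \<in> sets lborel" unfolding P_def by measurable
  have "emeasure lborel P \<le> emeasure lborel {0..1::real}" by (rule emeasure_mono) (auto simp: P_def)
  then have "emeasure lborel P \<noteq> \<infinity>" by (auto simp: top_unique)
  then have "ennreal (aligned_fraction E a T s y z) = emeasure lborel P"
    by (simp add: emeasure_eq_ennreal_measure aligned_fraction_def P_def)
  also have "\<dots> = (\<integral>\<^sup>+ \<tau>. indicator P \<tau> \<partial>lborel)" using P by simp
  also have "\<dots> = (\<integral>\<^sup>+ \<tau>. indicator {0..1} \<tau> * of_bool (aligned E a T (sgn (snd s - fst s)) (fst s + \<tau> *\<^sub>R (snd s - fst s)) y z) \<partial>lborel)"
    by (intro nn_integral_cong) (auto simp: P_def indicator_def)
  finally show ?thesis .
qed

lemma aligned_fraction_measurable [measurable (raw)]: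
  assumes [measurable]: "f \<in> borel_measurable M" "g \<in> borel_measurable M"
  shows "(\<lambda>x. ennreal (aligned_fraction E a T s (f x) (g x))) \<in> borel_measurable M"
  unfolding ennreal_aligned_fraction by measurable

lemma ennreal_aligned_length:
  "ennreal (aligned_length E a T G y z) = (\<Sum>s\<in>G. ennreal (dist (fst s) (snd s)) * ennreal (aligned_fraction E a T s y z))"
  unfolding aligned_length_def
  by (subst sum_ennreal[symmetric]) (auto simp: aligned_fraction_def ennreal_mult)

lemma aligned_length_measurable [measurable (raw)]:
  assumes [measurable]: "f \<in> borel_measurable M" "g \<in> borel_measurable M"
  shows "(\<lambda>x. ennreal (aligned_length E a T G (f x) (g x))) \<in> borel_measurable M"
  unfolding ennreal_aligned_length by measurable

text \<open>Tonelli: the mean over \<open>y\<close> and \<open>z\<close> is taken first, with the network point fixed, and its bound is the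
same for all points and directions. The integral along the network then contributes its total length.\<close>

lemma nn_integral_aligned_length_le:
  assumes E: "1 \<le> E" and T: "5 * E \<le> 2 * T"
    and \<kappa>: "0 < \<kappa>" "\<kappa> \<le> 1" and a: "a = \<kappa>\<^sup>2 / (E * T)"
    and D: "D \<in> sets borel" "D \<subseteq> cball c R" and V: "emeasure lborel D = ennreal V" "0 < V"
  shows "(\<integral>\<^sup>+ y. \<integral>\<^sup>+ z. ennreal (aligned_length E a T G y z) \<partial>uniform_on_region D \<partial>uniform_on_region D)
    \<le> ennreal (network_length G * (3456 * \<kappa> * T * R\<^sup>2 / V\<^sup>2))"
proof -
  define U where "U = uniform_on_region D"
  define C where "C = 3456 * \<kappa> * T * R\<^sup>2 / V\<^sup>2"
  have C0: "0 \<le> C" using \<kappa> T E by (auto simp: C_def)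
  interpret U: prob_space U unfolding U_def by (rule uniform_on_region_prob_space[OF V])
  interpret UL: pair_sigma_finite U lborel ..
  have [measurable_cong, simp]: "sets U = sets borel" by (simp add: U_def)
  have one: "ennreal (dist (fst s) (snd s)) * (\<integral>\<^sup>+ y. \<integral>\<^sup>+ z. ennreal (aligned_fraction E a T s y z) \<partial>U \<partial>U)
     \<le> ennreal (dist (fst s) (snd s)) * ennreal C" for s
  proof (cases "fst s = snd s")
    case False
    define v where "v = sgn (snd s - fst s)"
    define w where "w \<tau> = fst s + \<tau> *\<^sub>R (snd s - fst s)" for \<tau>
    have [measurable]: "w \<in> borel_measurable borel" unfolding w_def by measurable
    have v: "norm v = 1" using False by (simp add: v_def norm_sgn)
    have "(\<integral>\<^sup>+ y. \<integral>\<^sup>+ z. ennreal (aligned_fraction E a T s y z) \<partial>U \<partial>U)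
      = (\<integral>\<^sup>+ y. \<integral>\<^sup>+ z. \<integral>\<^sup>+ \<tau>. indicator {0..1} \<tau> * of_bool (aligned E a T v (w \<tau>) y z) \<partial>lborel \<partial>U \<partial>U)"
      unfolding ennreal_aligned_fraction v_def w_def ..
    also have "\<dots> = (\<integral>\<^sup>+ y. \<integral>\<^sup>+ \<tau>. \<integral>\<^sup>+ z. indicator {0..1} \<tau> * of_bool (aligned E a T v (w \<tau>) y z) \<partial>U \<partial>lborel \<partial>U)"
      by (intro nn_integral_cong UL.Fubini'[symmetric]) measurable
    also have "\<dots> = (\<integral>\<^sup>+ \<tau>. \<integral>\<^sup>+ y. \<integral>\<^sup>+ z. indicator {0..1} \<tau> * of_bool (aligned E a T v (w \<tau>) y z) \<partial>U \<partial>U \<partial>lborel)"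
      by (intro UL.Fubini'[symmetric]) measurable
    also have "\<dots> = (\<integral>\<^sup>+ \<tau>. indicator {0..1} \<tau> * (\<integral>\<^sup>+ y. \<integral>\<^sup>+ z. of_bool (aligned E a T v (w \<tau>) y z) \<partial>U \<partial>U) \<partial>lborel)"
      by (intro nn_integral_cong) (auto simp: indicator_def)
    also have "\<dots> \<le> (\<integral>\<^sup>+ \<tau>. indicator {0..1::real} \<tau> * ennreal C \<partial>lborel)"
    proof (rule nn_integral_mono)
      fix \<tau> :: real
      have "(\<integral>\<^sup>+ y. \<integral>\<^sup>+ z. of_bool (aligned E a T v (w \<tau>) y z) \<partial>U \<partial>U) \<le> ennreal C"
        unfolding U_def C_def by (rule nn_integral_aligned_le) (fact v E T \<kappa> a D V)+
      then show "indicator {0..1} \<tau> * (\<integral>\<^sup>+ y. \<integral>\<^sup>+ z. of_bool (aligned E a T v (w \<tau>) y z) \<partial>U \<partial>U)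
        \<le> indicator {0..1} \<tau> * ennreal C"
        by (rule mult_left_mono) simp
    qed
    also have "\<dots> = ennreal C" by (subst nn_integral_multc) auto
    finally show ?thesis by (rule mult_left_mono) simp
  qed simp
  have "(\<integral>\<^sup>+ y. \<integral>\<^sup>+ z. ennreal (aligned_length E a T G y z) \<partial>U \<partial>U)
    = (\<Sum>s\<in>G. ennreal (dist (fst s) (snd s)) * (\<integral>\<^sup>+ y. \<integral>\<^sup>+ z. ennreal (aligned_fraction E a T s y z) \<partial>U \<partial>U))"
    unfolding ennreal_aligned_length by (simp add: nn_integral_sum nn_integral_cmult)
  also have "\<dots> \<le> (\<Sum>s\<in>G. ennreal (dist (fst s) (snd s)) * ennreal C)"
    by (rule sum_mono) (rule one)
  also have "\<dots> = ennreal (\<Sum>s\<in>G. dist (fst s) (snd s) * C)"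
    using C0 by (subst sum_ennreal[symmetric]) (auto simp: ennreal_mult)
  also have "(\<Sum>s\<in>G. dist (fst s) (snd s) * C) = network_length G * C"
    by (simp add: network_length_def case_prod_unfold sum_distrib_right)
  finally show ?thesis by (simp add: U_def C_def)
qed

section \<open>Random pairs of points\<close>

text \<open>Two independent copies of a coupled pair are modelled by the product measure; a point \<open>\<omega>\<close> of that space is
\<open>((X1, Y1), (X2, Y2))\<close>.\<close>

locale coupled =
  fixes \<mu>1 \<mu>2 :: "plane measure" and \<nu> :: "(plane \<times> plane) measure"
  assumes coupling: "coupling \<mu>1 \<mu>2 \<nu>"
begin

lemma sets_\<nu> [measurable_cong, simp]: "sets \<nu> = sets (borel \<Otimes>\<^sub>M borel)"
  using coupling by (simp add: coupling_def)

lemma space_\<nu> [simp]: "space \<nu> = UNIV"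
  using sets_eq_imp_space_eq[OF sets_\<nu>] by (simp add: space_pair_measure)

sublocale prob_space \<nu>
  using coupling by (simp add: coupling_def)

sublocale PP: pair_prob_space \<nu> \<nu> ..

lemma marginals: "\<mu>1 = distr \<nu> borel fst" "\<mu>2 = distr \<nu> borel snd"
  using coupling by (auto simp: coupling_def)

lemma nn_integral_second_coordinates:
  assumes [measurable]: "case_prod h \<in> borel_measurable (borel \<Otimes>\<^sub>M borel)"
  shows "(\<integral>\<^sup>+\<omega>. h (snd (fst \<omega>)) (snd (snd \<omega>)) \<partial>(\<nu> \<Otimes>\<^sub>M \<nu>)) = (\<integral>\<^sup>+y. \<integral>\<^sup>+z. h y z \<partial>\<mu>2 \<partial>\<mu>2)"
proof -
  have "(\<integral>\<^sup>+\<omega>. h (snd (fst \<omega>)) (snd (snd \<omega>)) \<partial>(\<nu> \<Otimes>\<^sub>M \<nu>)) = (\<integral>\<^sup>+y. \<integral>\<^sup>+z. h (snd y) (snd z) \<partial>\<nu> \<partial>\<nu>)"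
    by (subst nn_integral_fst[symmetric]) auto
  also have "\<dots> = (\<integral>\<^sup>+y. \<integral>\<^sup>+z. h (snd y) z \<partial>\<mu>2 \<partial>\<nu>)"
    unfolding marginals by (intro nn_integral_cong) (subst nn_integral_distr, auto)
  also have "\<dots> = (\<integral>\<^sup>+y. \<integral>\<^sup>+z. h y z \<partial>\<mu>2 \<partial>\<mu>2)"
  proof -
    interpret M2: prob_space \<mu>2 unfolding marginals by (rule prob_space_distr) simp
    have [measurable_cong]: "sets \<mu>2 = sets borel" unfolding marginals by simp
    have "(\<lambda>y. \<integral>\<^sup>+z. h y z \<partial>\<mu>2) \<in> borel_measurable borel" by measurable
    then have "(\<integral>\<^sup>+y. (\<integral>\<^sup>+z. h y z \<partial>\<mu>2) \<partial>distr \<nu> borel snd) = (\<integral>\<^sup>+y. \<integral>\<^sup>+z. h (snd y) z \<partial>\<mu>2 \<partial>\<nu>)"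
      by (subst nn_integral_distr) auto
    then show ?thesis using marginals(2) by simp
  qed
  finally show ?thesis .
qed

lemma prob_rectangle:
  assumes [measurable]: "A \<in> sets \<nu>" "B \<in> sets \<nu>"
  shows "PP.prob (A \<times> B) = prob A * prob B"
    using assms by (simp add: measure_def emeasure_pair_measure_Times[of A \<nu> B] enn2real_mult del: sets_\<nu>)

end

lemma prob_uniform_close:
  assumes D: "D \<in> sets borel" and V: "emeasure lborel D = ennreal V" "0 < V" and r: "0 \<le> r"
  shows "(\<integral>\<^sup>+y. \<integral>\<^sup>+z. of_bool (dist y z < r) \<partial>uniform_on_region D \<partial>uniform_on_region D) \<le> ennreal (4 * r\<^sup>2 / V)"
proof -
  interpret U: prob_space "uniform_on_region D" by (rule uniform_on_region_prob_space[OF V])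
  have inner: "(\<integral>\<^sup>+z. of_bool (dist y z < r) \<partial>uniform_on_region D) \<le> ennreal (4 * r\<^sup>2 / V)" for y
  proof -
    define e :: plane where "e = axis 1 1"
    have e: "norm e = 1" by (simp add: e_def)
    define Q where "Q = {z. z - y \<in> rectangle e r r}"
    have Q: "emeasure lborel Q = ennreal (4 * r\<^sup>2)" "Q \<in> sets lborel"
      unfolding Q_def using emeasure_translated_rectangle[OF e r r, of y] by (simp_all add: power2_eq_square)
    have sub: "dist y z < r \<Longrightarrow> z \<in> Q" for z
      using Cauchy_Schwarz_ineq2[of "z - y" e] Cauchy_Schwarz_ineq2[of "z - y" "perp e"] e
      by (auto simp: Q_def rectangle_def dist_norm norm_minus_commute)
    have "(\<integral>\<^sup>+z. of_bool (dist y z < r) \<partial>uniform_on_region D)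
       = (\<integral>\<^sup>+z. of_bool (dist y z < r) * indicator D z \<partial>lborel) / ennreal V"
      unfolding uniform_on_region_def using D by (subst nn_integral_uniform_measure) (auto simp: V)
    also have "\<dots> \<le> (\<integral>\<^sup>+z. indicator Q z \<partial>lborel) / ennreal V"
      using sub by (intro divide_right_mono_ennreal nn_integral_mono) (auto simp: indicator_def)
    also have "\<dots> = ennreal (4 * r\<^sup>2 / V)" using Q V(2) by (simp add: divide_ennreal)
    finally show ?thesis .
  qed
  have "(\<integral>\<^sup>+y. \<integral>\<^sup>+z. of_bool (dist y z < r) \<partial>uniform_on_region D \<partial>uniform_on_region D)
     \<le> (\<integral>\<^sup>+y. ennreal (4 * r\<^sup>2 / V) \<partial>uniform_on_region D)"
    by (intro nn_integral_mono inner)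
  also have "\<dots> = ennreal (4 * r\<^sup>2 / V)" by (simp add: U.emeasure_space_1)
  finally show ?thesis .
qed

locale points_and_region =
  fixes Z D :: "plane set" and V :: real and \<nu> :: "(plane \<times> plane) measure"
  assumes coup: "coupling (uniform_on_points Z) (uniform_on_region D) \<nu>"
    and Z: "finite Z" "Z \<noteq> {}"
    and D: "D \<in> sets borel" and V: "emeasure lborel D = ennreal V" "0 < V"
begin

sublocale coupled "uniform_on_points Z" "uniform_on_region D" \<nu>
  by unfold_locales (rule coup)

lemma prob_first:
  assumes "A \<in> sets borel"
  shows "prob {w. fst w \<in> A} = card (Z \<inter> A) / card Z"
proof -
  have "prob {w. fst w \<in> A} = measure (distr \<nu> borel fst) A"
    using assms by (subst measure_distr) (auto simp: vimage_def)
  also have "\<dots> = measure (uniform_on_points Z) A" using marginals(1) by simp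
  also have "\<dots> = measure (uniform_count_measure Z) (Z \<inter> A)"
    unfolding uniform_on_points_def using assms
    by (subst measure_distr) (auto simp: space_uniform_count_measure sets_uniform_count_measure measurable_def Int_commute)
  also have "\<dots> = card (Z \<inter> A) / card Z"
    using Z by (subst measure_uniform_count_measure) auto
  finally show ?thesis .
qed

lemma prob_pair_in:
  assumes W: "W \<subseteq> Z \<times> Z"
  shows "PP.prob {\<omega>. (fst (fst \<omega>), fst (snd \<omega>)) \<in> W} \<le> card W / (card Z)\<^sup>2"
proof -
  have fin: "finite W" using W Z finite_subset by blast
  define F where "F p = {w :: plane \<times> plane. fst w = p}" for p
  have F: "F p \<in> sets \<nu>" for p
  proof -
    have "{w \<in> space \<nu>. fst w = p} \<in> sets \<nu>" by measurable
    then show ?thesis by (simp add: F_def)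
  qed
  have pF: "prob (F p) = 1 / card Z" if "p \<in> Z" for p
    using prob_first[of "{p}"] that by (simp add: F_def)
  have "{\<omega>. (fst (fst \<omega>), fst (snd \<omega>)) \<in> W} = (\<Union>w\<in>W. F (fst w) \<times> F (snd w))"
    by (force simp: F_def)
  then have "PP.prob {\<omega>. (fst (fst \<omega>), fst (snd \<omega>)) \<in> W} \<le> (\<Sum>w\<in>W. PP.prob (F (fst w) \<times> F (snd w)))"
    using fin F by (simp only:) (intro measure_UNION_le, auto)
  also have "\<dots> = (\<Sum>w\<in>W. 1 / (card Z)\<^sup>2)"
    using W F by (intro sum.cong) (auto simp: prob_rectangle pF power2_eq_square simp del: sets_\<nu>)
  finally show ?thesis by simp
qed

lemma prob_coordinate:
  assumes "A \<in> sets \<nu>"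
  shows "PP.prob {\<omega>. fst \<omega> \<in> A} = prob A" "PP.prob {\<omega>. snd \<omega> \<in> A} = prob A"
proof -
  have "{\<omega>. fst \<omega> \<in> A} = A \<times> space \<nu>" "{\<omega>. snd \<omega> \<in> A} = space \<nu> \<times> A" by auto
  then show "PP.prob {\<omega>. fst \<omega> \<in> A} = prob A" "PP.prob {\<omega>. snd \<omega> \<in> A} = prob A"
    using prob_rectangle[OF assms sets.top] prob_rectangle[OF sets.top assms]
    by (simp_all add: prob_space del: space_\<nu>)
qed

text \<open>Markov's inequality for the truncated distance, which equals 1 as soon as the distance reaches \<open>L\<close>.\<close>

lemma prob_far:
  assumes L: "0 < L" and tr: "(\<integral>w. min 1 (dist (fst w) (snd w) / L) \<partial>\<nu>) \<le> \<delta>"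
  shows "prob {w. L < dist (fst w) (snd w)} \<le> \<delta>"
proof -
  let ?h = "\<lambda>w. min 1 (dist (fst w) (snd w) / L)"
  have h: "?h \<in> borel_measurable \<nu>" by measurable
  have "integrable \<nu> ?h"
    by (rule integrable_const_bound[where B = 1]) (use L h in auto)
  then have "measure \<nu> {w \<in> space \<nu>. ?h w \<ge> 1} \<le> (\<integral>w. ?h w \<partial>\<nu>) / 1"
    by (intro integral_Markov_inequality_measure[where A = "{}"]) (use L in auto)
  moreover have "{w \<in> space \<nu>. ?h w \<ge> 1} \<in> sets \<nu>" by measurable
  then have "prob {w. L < dist (fst w) (snd w)} \<le> measure \<nu> {w \<in> space \<nu>. ?h w \<ge> 1}"
    using L by (intro finite_measure_mono) auto
  ultimately show ?thesis using tr by simp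
qed

lemma space_PP [simp]: "space (\<nu> \<Otimes>\<^sub>M \<nu>) = UNIV"
  by (simp add: space_pair_measure)

lemma near_measurable:
  "{\<omega>. dist (snd (fst \<omega>)) (snd (snd \<omega>)) < r} \<in> sets (\<nu> \<Otimes>\<^sub>M \<nu>)"
proof -
  have "{\<omega> \<in> space (\<nu> \<Otimes>\<^sub>M \<nu>). dist (snd (fst \<omega>)) (snd (snd \<omega>)) < r} \<in> sets (\<nu> \<Otimes>\<^sub>M \<nu>)"
    by measurable
  then show ?thesis by simp
qed

lemma prob_near:
  assumes "0 \<le> r" "32 * r\<^sup>2 \<le> V"
  shows "PP.prob {\<omega>. dist (snd (fst \<omega>)) (snd (snd \<omega>)) < r} \<le> 1 / 8"
proof -
  have m: "{\<omega>. dist (snd (fst \<omega>)) (snd (snd \<omega>)) < r} \<in> sets (\<nu> \<Otimes>\<^sub>M \<nu>)"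
    by (rule near_measurable)
  have "ennreal (PP.prob {\<omega>. dist (snd (fst \<omega>)) (snd (snd \<omega>)) < r})
    = (\<integral>\<^sup>+\<omega>. indicator {\<omega>. dist (snd (fst \<omega>)) (snd (snd \<omega>)) < r} \<omega> \<partial>(\<nu> \<Otimes>\<^sub>M \<nu>))"
    using m by (simp add: PP.emeasure_eq_measure)
  also have "\<dots> = (\<integral>\<^sup>+\<omega>. of_bool (dist (snd (fst \<omega>)) (snd (snd \<omega>)) < r) \<partial>(\<nu> \<Otimes>\<^sub>M \<nu>))"
    by (intro nn_integral_cong) (auto simp: indicator_def)
  also have "\<dots> = (\<integral>\<^sup>+y. \<integral>\<^sup>+z. of_bool (dist y z < r) \<partial>uniform_on_region D \<partial>uniform_on_region D)"
    by (rule nn_integral_second_coordinates) measurable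
  also have "\<dots> \<le> ennreal (4 * r\<^sup>2 / V)" by (rule prob_uniform_close[OF D V assms(1)])
  also have "\<dots> \<le> ennreal (1 / 8)" using assms V by (intro ennreal_leI) (simp add: field_simps)
  finally show ?thesis by (simp add: ennreal_le_iff)
qed

lemma card_large_excess:
  assumes net: "network Z G" and E: "0 < E"
    and ex: "(\<Sum>(p, q)\<in>distinct_pairs Z. network_dist G p q - dist p q) \<le> \<delta> * E"
  shows "real (card {(p, q) \<in> distinct_pairs Z. E \<le> network_dist G p q - dist p q}) \<le> \<delta>"
proof -
  let ?W = "{(p, q) \<in> distinct_pairs Z. E \<le> network_dist G p q - dist p q}"
  have fin: "finite (distinct_pairs Z)"
    by (rule finite_subset[of _ "Z \<times> Z"]) (use Z in \<open>auto simp: distinct_pairs_def\<close>)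
  have "real (card ?W) * E = (\<Sum>w\<in>?W. E)" by simp
  also have "\<dots> \<le> (\<Sum>(p, q)\<in>?W. network_dist G p q - dist p q)"
    by (intro sum_mono) auto
  also have "\<dots> \<le> (\<Sum>(p, q)\<in>distinct_pairs Z. network_dist G p q - dist p q)"
    using fin network_dist_ge[OF net] by (intro sum_mono2) (auto simp: distinct_pairs_def)
  also have "\<dots> \<le> \<delta> * E" by (rule ex)
  finally show ?thesis using E by simp
qed

text \<open>On an event of probability at least one half, the random pair of companions \<open>Y1\<close>, \<open>Y2\<close> satisfies the
deterministic inequality with \<open>a k = \<kappa>\<^sup>2 / (E 2^k)\<close>, for which each of the \<open>K\<close> scales contributes
\<open>\<kappa>\<^sup>2 / E\<close>. For small \<open>\<kappa>\<close> the mean of the aligned length accounts for at most a quarter of that, and the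
remaining quarter of \<open>K \<kappa>\<^sup>2 / E\<close> must be below the waste \<open>5 E\<close>.\<close>

lemma scale_count_bound:
  assumes net: "network Z G" and c: "D \<subseteq> cball c R"
    and L: "0 < L" "L \<le> E" and E: "1 \<le> E"
    and tr: "(\<integral>w. min 1 (dist (fst w) (snd w) / L) \<partial>\<nu>) \<le> 1 / 16"
    and ex: "(\<Sum>(p, q)\<in>distinct_pairs Z. network_dist G p q - dist p q) \<le> (card Z)\<^sup>2 / 16 * E"
    and K: "5 * E \<le> 2 ^ K" "2 ^ (2 * K) + E \<le> r" "32 * r\<^sup>2 \<le> V"
    and \<kappa>: "0 < \<kappa>" "\<kappa> \<le> 1" "13824 * \<kappa> * R\<^sup>2 * network_length G \<le> V\<^sup>2"
  shows "real K * \<kappa>\<^sup>2 \<le> 20 * E\<^sup>2"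
proof -
  define a where "a k = \<kappa>\<^sup>2 / (E * 2 ^ k)" for k :: nat
  define S where "S = (\<Sum>k\<in>{K..<2 * K}. a k * 2 ^ k)"
  define H where "H y z = (\<Sum>k\<in>{K..<2 * K}. a k * aligned_length E (a k) (2 ^ k) G y z)" for y z
  define W where "W = {(p, q) \<in> distinct_pairs Z. E \<le> network_dist G p q - dist p q}"
  define far where "far = {w :: plane \<times> plane. L < dist (fst w) (snd w)}"
  define off where "off = {w :: plane \<times> plane. fst w \<in> - Z}"
  \<comment> \<open>The exceptional event: the two points have large excess, one of them is off the
      configuration (a null event), one of them is far from its companion, or the companions are
      near each other. These have probability at most 1/16, 0, 1/8 and 1/8.\<close>
  define B where "B = {\<omega> :: (plane \<times> plane) \<times> (plane \<times> plane). (fst (fst \<omega>), fst (snd \<omega>)) \<in> W}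
     \<union> {\<omega>. fst \<omega> \<in> off} \<union> {\<omega>. snd \<omega> \<in> off}
     \<union> {\<omega>. fst \<omega> \<in> far} \<union> {\<omega>. snd \<omega> \<in> far} \<union> {\<omega>. dist (snd (fst \<omega>)) (snd (snd \<omega>)) < r}"
  have WZ: "W \<subseteq> Z \<times> Z" by (auto simp: W_def distinct_pairs_def)
  then have finW: "finite W" using Z finite_subset by blast
  have r0: "0 \<le> r" using K(2) E by (smt (verit) zero_le_power)
  have Sval: "S = real K * \<kappa>\<^sup>2 / E"
    using E by (simp add: S_def a_def field_simps)
  have a0: "0 \<le> a k" for k using E by (simp add: a_def)
  have a1: "a k \<le> 1" for k
  proof -
    have "\<kappa>\<^sup>2 \<le> 1" using \<kappa> by (simp add: power_le_one)
    also have "1 \<le> E * 2 ^ k" using E mult_mono[of 1 E 1 "2 ^ k"] by simp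
    finally show ?thesis using E by (simp add: a_def)
  qed
  have farm: "far \<in> sets \<nu>"
  proof -
    have "{w \<in> space \<nu>. L < dist (fst w) (snd w)} \<in> sets \<nu>" by measurable
    then show ?thesis by (simp add: far_def)
  qed
  have Zb: "- Z \<in> sets borel" using Z by (intro borel_comp finite_imp_closed[THEN borel_closed])
  have offm: "off \<in> sets \<nu>"
  proof -
    have "fst -` (- Z) \<inter> space \<nu> \<in> sets \<nu>" by (rule measurable_sets[OF _ Zb]) measurable
    then show ?thesis by (simp add: off_def vimage_def)
  qed
  have Wb: "W \<in> sets (borel \<Otimes>\<^sub>M borel)"
    unfolding borel_prod using finW by (intro borel_closed finite_imp_closed)
  have Wm: "{\<omega>. (fst (fst \<omega>), fst (snd \<omega>)) \<in> W} \<in> sets (\<nu> \<Otimes>\<^sub>M \<nu>)"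
  proof -
    have "(\<lambda>\<omega>. (fst (fst \<omega>), fst (snd \<omega>))) -` W \<inter> space (\<nu> \<Otimes>\<^sub>M \<nu>) \<in> sets (\<nu> \<Otimes>\<^sub>M \<nu>)"
      by (rule measurable_sets[OF _ Wb]) measurable
    then show ?thesis by (simp add: vimage_def)
  qed
  have coord: "{\<omega>. fst \<omega> \<in> A} \<in> sets (\<nu> \<Otimes>\<^sub>M \<nu>)" "{\<omega>. snd \<omega> \<in> A} \<in> sets (\<nu> \<Otimes>\<^sub>M \<nu>)"
    if "A \<in> sets \<nu>" for A
    using measurable_sets[OF measurable_fst that, of \<nu>] measurable_sets[OF measurable_snd that, of \<nu>]
    by (simp_all add: vimage_def)
  note sets = Wm coord[OF offm] coord[OF farm] near_measurable[of r]
  have union6: "measure M (A1 \<union> A2 \<union> A3 \<union> A4 \<union> A5 \<union> A6) \<le>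
      measure M A1 + measure M A2 + measure M A3 + measure M A4 + measure M A5 + measure M A6"
    if "A1 \<in> sets M" "A2 \<in> sets M" "A3 \<in> sets M" "A4 \<in> sets M" "A5 \<in> sets M" "A6 \<in> sets M"
    for M :: "'m measure" and A1 A2 A3 A4 A5 A6
    using measure_Un_le[of "A1 \<union> A2 \<union> A3 \<union> A4 \<union> A5" M A6] measure_Un_le[of "A1 \<union> A2 \<union> A3 \<union> A4" M A5]
      measure_Un_le[of "A1 \<union> A2 \<union> A3" M A4] measure_Un_le[of "A1 \<union> A2" M A3] measure_Un_le[of A1 M A2] that
    by (auto simp: sets.Un)
  have Bm: "B \<in> sets (\<nu> \<Otimes>\<^sub>M \<nu>)" unfolding B_def by (intro sets.Un sets)
  have "PP.prob B \<le> PP.prob {\<omega>. (fst (fst \<omega>), fst (snd \<omega>)) \<in> W}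
     + PP.prob {\<omega>. fst \<omega> \<in> off} + PP.prob {\<omega>. snd \<omega> \<in> off}
     + PP.prob {\<omega>. fst \<omega> \<in> far} + PP.prob {\<omega>. snd \<omega> \<in> far}
     + PP.prob {\<omega>. dist (snd (fst \<omega>)) (snd (snd \<omega>)) < r}"
    unfolding B_def
    by (rule union6[OF sets])
  moreover have "PP.prob {\<omega>. (fst (fst \<omega>), fst (snd \<omega>)) \<in> W} \<le> 1 / 16"
  proof -
    have "real (card W) \<le> (card Z)\<^sup>2 / 16"
      unfolding W_def using card_large_excess[OF net _ ex] E by simp
    then have "card W / (card Z)\<^sup>2 \<le> 1 / 16"
      using Z by (simp add: field_simps card_gt_0_iff)
    then show ?thesis using prob_pair_in[OF WZ] by linarith
  qed
  moreover have "prob off = 0"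
    unfolding off_def using prob_first[OF Zb] by simp
  moreover have "prob far \<le> 1 / 16" unfolding far_def by (rule prob_far[OF L(1) tr])
  ultimately have PB: "PP.prob B \<le> 1 / 2"
    using prob_near[OF r0 K(3)] prob_coordinate[OF offm] prob_coordinate[OF farm] by linarith
  have good: "S \<le> 5 * E + H (snd (fst \<omega>)) (snd (snd \<omega>))" if "\<omega> \<notin> B" for \<omega>
  proof -
    have "(2::real) ^ K \<le> 2 ^ (2 * K)" by (rule power_increasing) auto
    then have "2 * L < r" using K L E by linarith
    then show ?thesis
      unfolding S_def H_def
      using that K L E a0 a1
      by (intro aligned_length_lower_bound[OF net, of "fst (fst \<omega>)" "fst (snd \<omega>)" _ _ L])
        (auto simp: B_def W_def off_def far_def distinct_pairs_def not_less not_le)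
  qed
  have H0: "0 \<le> H y z" for y z unfolding H_def by (intro sum_nonneg mult_nonneg_nonneg a0 aligned_length_nonneg)
  have Hm: "(\<lambda>x. ennreal (H (f x) (g x))) \<in> borel_measurable M"
    if [measurable]: "f \<in> borel_measurable M" "g \<in> borel_measurable M" for f g and M :: "'m measure"
  proof -
    have "(\<lambda>x. ennreal (H (f x) (g x))) = (\<lambda>x. \<Sum>k\<in>{K..<2 * K}. ennreal (a k) * ennreal (aligned_length E (a k) (2 ^ k) G (f x) (g x)))"
      unfolding H_def using a0 aligned_length_nonneg
      by (simp add: sum_ennreal[symmetric] ennreal_mult)
    then show ?thesis by simp
  qed
  have "(\<integral>\<^sup>+\<omega>. ennreal (H (snd (fst \<omega>)) (snd (snd \<omega>))) \<partial>(\<nu> \<Otimes>\<^sub>M \<nu>))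
     = (\<integral>\<^sup>+y. \<integral>\<^sup>+z. ennreal (H y z) \<partial>uniform_on_region D \<partial>uniform_on_region D)"
    by (rule nn_integral_second_coordinates) (simp add: case_prod_unfold Hm)
  also have "\<dots> = (\<Sum>k\<in>{K..<2 * K}. ennreal (a k) *
      (\<integral>\<^sup>+y. \<integral>\<^sup>+z. ennreal (aligned_length E (a k) (2 ^ k) G y z) \<partial>uniform_on_region D \<partial>uniform_on_region D))"
  proof -
    interpret U: prob_space "uniform_on_region D" by (rule uniform_on_region_prob_space[OF V])
    have H: "ennreal (H y z) = (\<Sum>k\<in>{K..<2 * K}. ennreal (a k) * ennreal (aligned_length E (a k) (2 ^ k) G y z))" for y z
      unfolding H_def using a0 aligned_length_nonneg
      by (simp add: sum_ennreal[symmetric] ennreal_mult)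
    show ?thesis unfolding H by (simp add: nn_integral_sum nn_integral_cmult)
  qed
  also have "\<dots> \<le> (\<Sum>k\<in>{K..<2 * K}. ennreal (a k) * ennreal (2 ^ k / 4))"
  proof (intro sum_mono mult_left_mono)
    fix k assume k: "k \<in> {K..<2 * K}"
    have "(2::real) ^ K \<le> 2 ^ k" using k by (auto intro: power_increasing)
    moreover have "(0::real) \<le> 2 ^ k" by simp
    ultimately have T: "5 * E \<le> 2 * 2 ^ k" using K by linarith
    have "(\<integral>\<^sup>+y. \<integral>\<^sup>+z. ennreal (aligned_length E (a k) (2 ^ k) G y z) \<partial>uniform_on_region D \<partial>uniform_on_region D)
      \<le> ennreal (network_length G * (3456 * \<kappa> * 2 ^ k * R\<^sup>2 / V\<^sup>2))"
      by (rule nn_integral_aligned_length_le[OF E T \<kappa>(1,2) a_def D c V])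
    also have "\<dots> \<le> ennreal (2 ^ k / 4)"
    proof (rule ennreal_leI)
      have "network_length G * (3456 * \<kappa> * 2 ^ k * R\<^sup>2 / V\<^sup>2)
         = (13824 * \<kappa> * R\<^sup>2 * network_length G) * (2 ^ k / 4 / V\<^sup>2)"
        by simp
      also have "\<dots> \<le> V\<^sup>2 * (2 ^ k / 4 / V\<^sup>2)" by (intro mult_right_mono \<kappa>) simp
      also have "\<dots> = 2 ^ k / 4" using V by simp
      finally show "network_length G * (3456 * \<kappa> * 2 ^ k * R\<^sup>2 / V\<^sup>2) \<le> 2 ^ k / 4" .
    qed
    finally show "(\<integral>\<^sup>+y. \<integral>\<^sup>+z. ennreal (aligned_length E (a k) (2 ^ k) G y z) \<partial>uniform_on_region D \<partial>uniform_on_region D)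
      \<le> ennreal (2 ^ k / 4)" .
  qed simp
  also have "\<dots> = (\<Sum>k\<in>{K..<2 * K}. ennreal (a k * (2 ^ k / 4)))"
    using a0 by (intro sum.cong refl ennreal_mult[symmetric]) auto
  also have "\<dots> = ennreal (\<Sum>k\<in>{K..<2 * K}. a k * (2 ^ k / 4))"
    using a0 by (intro sum_ennreal) auto
  also have "(\<Sum>k\<in>{K..<2 * K}. a k * (2 ^ k / 4)) = S / 4"
    by (simp add: S_def sum_divide_distrib)
  finally have IH: "(\<integral>\<^sup>+\<omega>. ennreal (H (snd (fst \<omega>)) (snd (snd \<omega>))) \<partial>(\<nu> \<Otimes>\<^sub>M \<nu>)) \<le> ennreal (S / 4)" .
  have S0: "0 \<le> S" unfolding S_def using a0 by (intro sum_nonneg) simp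
  \<comment> \<open>Integrate the deterministic inequality over the complement of B.\<close>
  have "ennreal (S / 2) \<le> ennreal (S * PP.prob (- B))"
    using PB S0 PP.prob_compl[OF Bm] mult_left_mono[of "1/2" "PP.prob (- B)" S]
    by (intro ennreal_leI) (simp add: Compl_eq_Diff_UNIV)
  also have "\<dots> = (\<integral>\<^sup>+\<omega>. ennreal S * indicator (- B) \<omega> \<partial>(\<nu> \<Otimes>\<^sub>M \<nu>))"
    using S0 sets.compl_sets[OF Bm]
    by (subst nn_integral_cmult_indicator) (simp_all add: ennreal_mult PP.emeasure_eq_measure Compl_eq_Diff_UNIV)
  also have "\<dots> \<le> (\<integral>\<^sup>+\<omega>. ennreal (5 * E) + ennreal (H (snd (fst \<omega>)) (snd (snd \<omega>))) \<partial>(\<nu> \<Otimes>\<^sub>M \<nu>))"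
  proof (rule nn_integral_mono)
    fix \<omega>
    have "ennreal S \<le> ennreal (5 * E) + ennreal (H (snd (fst \<omega>)) (snd (snd \<omega>)))" if "\<omega> \<notin> B"
    proof -
      have "ennreal S \<le> ennreal (5 * E + H (snd (fst \<omega>)) (snd (snd \<omega>)))"
        using good[OF that] by (rule ennreal_leI)
      then show ?thesis using E H0 by (simp del: ennreal_plus add: ennreal_plus[symmetric])
    qed
    then show "ennreal S * indicator (- B) \<omega> \<le> ennreal (5 * E) + ennreal (H (snd (fst \<omega>)) (snd (snd \<omega>)))"
      by (cases "\<omega> \<in> B") simp_all
  qed
  also have "\<dots> = ennreal (5 * E) + (\<integral>\<^sup>+\<omega>. ennreal (H (snd (fst \<omega>)) (snd (snd \<omega>))) \<partial>(\<nu> \<Otimes>\<^sub>M \<nu>))"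
    by (subst nn_integral_add) (simp_all add: Hm PP.emeasure_space_1 del: space_PP)
  also have "\<dots> \<le> ennreal (5 * E + S / 4)"
    using IH E S0 by (subst ennreal_plus) (auto intro: add_left_mono)
  finally have "S / 2 \<le> 5 * E + S / 4" using E S0 by (simp add: ennreal_le_iff del: ennreal_plus)
  then show ?thesis using E unfolding Sval by (simp add: field_simps power2_eq_square)
qed

end

section \<open>Asymptotics\<close>

lemma sum_excess_le:
  fixes e :: real
  assumes net: "network X G" and X: "finite X" and Z: "Z \<subseteq> X" and e: "excess X G \<le> e" "0 \<le> e"
  shows "(\<Sum>(p, q)\<in>distinct_pairs Z. network_dist G p q - dist p q) \<le> (card X)\<^sup>2 * e"
proof -
  have sub: "distinct_pairs X \<subseteq> X \<times> X" by (auto simp: distinct_pairs_def)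
  then have fin: "finite (distinct_pairs X)" using X finite_subset by blast
  have "card (distinct_pairs X) \<le> (card X)\<^sup>2"
    using card_mono[OF _ sub] X by (simp add: power2_eq_square card_cartesian_product)
  then have c: "real (card (distinct_pairs X)) \<le> (card X)\<^sup>2" by (simp only: of_nat_le_iff)
  have "(\<Sum>(p, q)\<in>distinct_pairs Z. network_dist G p q - dist p q)
     \<le> (\<Sum>(p, q)\<in>distinct_pairs X. network_dist G p q - dist p q)"
    using fin Z network_dist_ge[OF net] by (intro sum_mono2) (auto simp: distinct_pairs_def)
  also have "\<dots> = card (distinct_pairs X) * excess X G"
    using fin by (simp add: excess_def)
  also have "\<dots> \<le> card (distinct_pairs X) * e" using e by (intro mult_left_mono) auto
  also have "\<dots> \<le> (card X)\<^sup>2 * e" using c e by (intro mult_right_mono) auto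
  finally show ?thesis .
qed

text \<open>With \<open>K = scales n\<close> the dyadic scales from \<open>K\<close> to \<open>2 K\<close> cover the distances from about \<open>n\<close> to the power 1/8 up
to about \<open>n\<close> to the power 1/4. These lie well between the admissible excess, of order \<open>sqrt (ln n)\<close>, and
the diameter of the region, of order \<open>sqrt n\<close>, and still there are of order \<open>ln n\<close> of them.\<close>

definition scales :: "nat \<Rightarrow> nat" where
  "scales n = nat \<lfloor>log 2 (real n) / 8\<rfloor>"

lemma scales_bounds:
  assumes "n \<ge> 1"
  shows "ln (real n) / 8 - 1 \<le> scales n" "real n powr (1 / 8) / 2 \<le> 2 ^ scales n"
    "2 ^ (2 * scales n) \<le> real n powr (1 / 4)"
proof -
  have l0: "0 \<le> log 2 (real n)" using assms by simp
  have K: "log 2 (real n) / 8 - 1 \<le> scales n" "scales n \<le> log 2 (real n) / 8"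
    unfolding scales_def using l0 by linarith+
  have "ln 2 \<le> (1::real)" using ln_le_minus_one[of 2] by simp
  then have "ln (real n) \<le> log 2 (real n)"
    using assms by (simp add: log_def field_simps mult_left_le)
  then show "ln (real n) / 8 - 1 \<le> scales n" using K by linarith
  have pw: "2 powr (log 2 (real n) * t) = real n powr t" for t
    using assms by (simp add: powr_powr[symmetric])
  have "real n powr (1 / 8) / 2 = 2 powr (log 2 (real n) / 8 - 1)"
    using pw[of "1/8"] by (simp add: powr_diff)
  also have "\<dots> \<le> 2 powr (scales n)" using K by (intro powr_mono) auto
  finally show "real n powr (1 / 8) / 2 \<le> 2 ^ scales n" by (simp add: powr_realpow)
  have "(2::real) ^ (2 * scales n) = 2 powr (real (2 * scales n))" by (subst powr_realpow) auto
  also have "\<dots> \<le> 2 powr (log 2 (real n) / 4)" using K by (intro powr_mono) auto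
  also have "\<dots> = real n powr (1 / 4)" using pw[of "1/4"] by simp
  finally show "2 ^ (2 * scales n) \<le> real n powr (1 / 4)" .
qed

text \<open>Both cases of the theorem in one: a positive fraction of the configuration is equidistributed in
regions whose area and squared radius are proportional to \<open>n\<close>. Passing to the subconfiguration is harmless
because every pair has nonnegative excess: the mean excess grows at most by a constant factor.\<close>

lemma excess_liminf_pos:
  fixes x Z D :: "nat \<Rightarrow> plane set" and G :: "nat \<Rightarrow> segments" and L :: "nat \<Rightarrow> real" and c \<alpha> \<beta> :: real
  assumes x: "\<And>n. n \<ge> 1 \<Longrightarrow> finite (x n) \<and> card (x n) = n"
    and L: "\<And>n. n \<ge> 1 \<Longrightarrow> L n > 0" "L \<in> o(\<lambda>n. sqrt (ln (real n)))"
    and Z: "\<And>n. n \<ge> 1 \<Longrightarrow> Z n \<subseteq> x n" "\<And>n. n \<ge> 1 \<Longrightarrow> c * real n \<le> card (Z n)" "0 < c"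
    and D: "\<And>n. n \<ge> 1 \<Longrightarrow> D n \<in> sets borel" "\<And>n. n \<ge> 1 \<Longrightarrow> emeasure lborel (D n) = ennreal (\<alpha> * real n)"
      "\<And>n. n \<ge> 1 \<Longrightarrow> \<exists>p. D n \<subseteq> cball p (sqrt (\<beta> * real n))" "0 < \<alpha>" "0 < \<beta>"
    and eq: "equidistributed L Z (\<lambda>n. uniform_on_region (D n))"
    and net: "\<And>n. n \<ge> 1 \<Longrightarrow> network (x n) (G n)"
    and B: "Bseq (\<lambda>n. network_length (G n) / real n)"
  shows "liminf (\<lambda>n. ereal (excess (x n) (G n) / sqrt (ln (real n)))) > 0"
proof -
  obtain \<Lambda> where \<Lambda>: "0 < \<Lambda>" "\<And>n. norm (network_length (G n) / real n) \<le> \<Lambda>"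
    using B by (auto elim: BseqE)
  have len: "network_length (G n) \<le> \<Lambda> * n" if "n \<ge> 1" for n
    using \<Lambda>(2)[of n] that by (simp add: field_simps abs_le_iff)
  obtain \<nu> where \<nu>: "\<And>n. n \<ge> 1 \<Longrightarrow> coupling (uniform_on_points (Z n)) (uniform_on_region (D n)) (\<nu> n)"
    "(\<lambda>n. \<integral>w. min 1 (dist (fst w) (snd w) / L n) \<partial>\<nu> n) \<longlonglongrightarrow> 0"
    using eq unfolding equidistributed_def by blast
  \<comment> \<open>Small enough for the mean of the aligned length to account for a quarter of each scale.\<close>
  define \<kappa> where "\<kappa> = min 1 (\<alpha>\<^sup>2 / (13824 * \<beta> * \<Lambda>))"
  have \<kappa>: "0 < \<kappa>" "\<kappa> \<le> 1" "13824 * \<kappa> * \<beta> * \<Lambda> \<le> \<alpha>\<^sup>2"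
  proof -
    have "\<kappa> \<le> \<alpha>\<^sup>2 / (13824 * \<beta> * \<Lambda>)" by (simp add: \<kappa>_def)
    then show "13824 * \<kappa> * \<beta> * \<Lambda> \<le> \<alpha>\<^sup>2" using D(5) \<Lambda> by (simp add: field_simps)
  qed (use D \<Lambda> in \<open>auto simp: \<kappa>_def\<close>)
  \<comment> \<open>With E = \<eta> sqrt (ln n), 20 E^2 = \<kappa>^2 ln n / 20, whereas the number of scales is
      about ln n / 8.\<close>
  define \<eta> where "\<eta> = \<kappa> / 20"
  \<comment> \<open>Markov's inequality then leaves at most one pair in sixteen with excess above E.\<close>
  define \<delta> where "\<delta> = \<eta> * c\<^sup>2 / 16"
  have \<eta>: "0 < \<eta>" and \<delta>: "0 < \<delta>" using \<kappa> Z(3) by (auto simp: \<eta>_def \<delta>_def)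
  have "eventually (\<lambda>n. norm (L n) \<le> \<eta> * norm (sqrt (ln (real n)))) sequentially"
    by (rule landau_o.smallD[OF L(2) \<eta>])
  moreover have "eventually (\<lambda>n. 1 \<le> \<eta> * sqrt (ln (real n))) sequentially"
    using \<eta> by real_asymp
  moreover have "eventually (\<lambda>n. 5 * (\<eta> * sqrt (ln (real n))) \<le> real n powr (1 / 8) / 2) sequentially"
    using \<eta> by real_asymp
  moreover have "eventually (\<lambda>n. real n powr (1 / 4) + \<eta> * sqrt (ln (real n)) \<le> sqrt (\<alpha> * real n / 32)) sequentially"
    using \<eta> D(4) by real_asymp
  moreover have "eventually (\<lambda>n. (\<integral>w. min 1 (dist (fst w) (snd w) / L n) \<partial>\<nu> n) < 1 / 16) sequentially"
    using order_tendstoD(2)[OF \<nu>(2), of "1/16"] by simp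
  moreover have "eventually (\<lambda>n. ln (real n) / 20 < ln (real n) / 8 - 1) sequentially"
    by real_asymp
  moreover have "eventually (\<lambda>n. n \<ge> 1) sequentially" by (rule eventually_ge_at_top)
  ultimately have "eventually (\<lambda>n. \<delta> \<le> excess (x n) (G n) / sqrt (ln (real n))) sequentially"
  proof eventually_elim
    case (elim n)
    define E where "E = \<eta> * sqrt (ln (real n))"
    have n: "n \<ge> 1" using elim by simp
    have E1: "1 \<le> E" using elim by (simp add: E_def)
    then have "0 < \<eta> * sqrt (ln (real n))" by (simp add: E_def)
    then have l0: "0 < sqrt (ln (real n))" using \<eta> by (rule zero_less_mult_pos)
    then have ln0: "0 < ln (real n)" by simp
    show ?case
    proof (rule ccontr)
      assume "\<not> ?case"
      then have ex: "excess (x n) (G n) \<le> \<delta> * sqrt (ln (real n))" using l0 by (simp add: field_simps)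
      interpret pr: points_and_region "Z n" "D n" "\<alpha> * n" "\<nu> n"
      proof
        show "finite (Z n)" using Z(1)[OF n] x[OF n] finite_subset by blast
        have "0 < c * n" using Z(3) n by simp
        then show "Z n \<noteq> {}" using Z(2)[OF n] by auto
        show "0 < \<alpha> * n" using D(4) n by simp
      qed (use \<nu>(1) D n in auto)
      obtain p where p: "D n \<subseteq> cball p (sqrt (\<beta> * n))" using D(3)[OF n] by blast
      have netZ: "network (Z n) (G n)"
        using net[OF n] Z(1)[OF n] unfolding network_def by blast
      have "real (scales n) * \<kappa>\<^sup>2 \<le> 20 * E\<^sup>2"
      proof (rule pr.scale_count_bound[OF netZ p L(1)[OF n]])
        show "L n \<le> E" using elim L(1)[OF n] l0 by (simp add: E_def)
        show "(\<integral>w. min 1 (dist (fst w) (snd w) / L n) \<partial>\<nu> n) \<le> 1 / 16" using elim by simp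
        show "5 * E \<le> 2 ^ scales n" using elim scales_bounds(2)[OF n] by (simp add: E_def)
        show "2 ^ (2 * scales n) + E \<le> sqrt (\<alpha> * n / 32)" using elim scales_bounds(3)[OF n] by (simp add: E_def)
        show "32 * (sqrt (\<alpha> * n / 32))\<^sup>2 \<le> \<alpha> * n" using D(4) by simp
        have "13824 * \<kappa> * (sqrt (\<beta> * n))\<^sup>2 * network_length (G n) \<le> 13824 * \<kappa> * (\<beta> * n) * (\<Lambda> * n)"
          using \<kappa> D(5) len[OF n] by (simp add: mult_left_mono)
        also have "\<dots> = (13824 * \<kappa> * \<beta> * \<Lambda>) * (real n)\<^sup>2" by (simp add: power2_eq_square)
        also have "\<dots> \<le> \<alpha>\<^sup>2 * (real n)\<^sup>2" by (intro mult_right_mono \<kappa>) simp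
        finally show "13824 * \<kappa> * (sqrt (\<beta> * n))\<^sup>2 * network_length (G n) \<le> (\<alpha> * n)\<^sup>2"
          by (simp add: power_mult_distrib)
        have "(\<Sum>(p, q)\<in>distinct_pairs (Z n). network_dist (G n) p q - dist p q)
            \<le> (card (x n))\<^sup>2 * (\<delta> * sqrt (ln (real n)))"
          using ex \<delta> l0 x[OF n] Z(1)[OF n] net[OF n] by (intro sum_excess_le) auto
        also have "\<dots> = (c * n)\<^sup>2 / 16 * E" using x[OF n] by (simp add: \<delta>_def E_def power_mult_distrib)
        also have "\<dots> \<le> (real (card (Z n)))\<^sup>2 / 16 * E"
          using Z(2)[OF n] Z(3) E1 by (intro mult_right_mono divide_right_mono power_mono) auto
        finally show "(\<Sum>(p, q)\<in>distinct_pairs (Z n). network_dist (G n) p q - dist p q)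
          \<le> real ((card (Z n))\<^sup>2) / 16 * E" by simp
      qed (use E1 \<kappa> in auto)
      also have "20 * E\<^sup>2 = \<kappa>\<^sup>2 * (ln (real n) / 20)"
        using ln0 by (simp add: E_def \<eta>_def power_mult_distrib power_divide)
      finally have "real (scales n) \<le> ln (real n) / 20" using \<kappa>(1) by (simp add: mult.commute)
      then show False using elim scales_bounds(1)[OF n] by linarith
    qed
  qed
  then have "ereal \<delta> \<le> liminf (\<lambda>n. ereal (excess (x n) (G n) / sqrt (ln (real n))))"
    by (intro Liminf_bounded) simp
  then show ?thesis using \<delta> by (metis ereal_less(2) less_le_trans)
qed

lemma square_eq_cbox: "square s = cbox 0 (\<chi> i. s)"
  by (auto simp: square_def mem_box_cart)

lemma emeasure_square: "0 \<le> s \<Longrightarrow> emeasure lborel (square s) = ennreal (s\<^sup>2)"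
proof -
  assume s: "0 \<le> s"
  then have "(0::plane) \<in> cbox 0 (\<chi> i. s)" by (simp add: mem_box_cart)
  then have "measure lborel (square s) = s\<^sup>2"
    unfolding square_eq_cbox using s
    by (subst content_cbox_cart) (auto simp: power2_eq_square UNIV_2)
  moreover have "emeasure lborel (square s) \<noteq> \<infinity>"
    unfolding square_eq_cbox using emeasure_lborel_cbox_finite by (metis infinity_ennreal_def less_irrefl)
  ultimately show ?thesis by (simp add: emeasure_eq_ennreal_measure)
qed

lemma square_subset_cball: "0 \<le> s \<Longrightarrow> square (sqrt s) \<subseteq> cball 0 (sqrt (2 * s))"
proof
  fix p assume s: "0 \<le> s" and p: "p \<in> square (sqrt s)"
  have "(p $ i)\<^sup>2 \<le> s" for i
    using p s power_mono[of "p $ i" "sqrt s" 2] by (auto simp: square_def)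
  from this[of 1] this[of 2] have "(norm p)\<^sup>2 \<le> 2 * s" by (simp add: norm_plane_sq)
  then show "p \<in> cball 0 (sqrt (2 * s))" by (simp add: real_le_rsqrt)
qed

text \<open>A disk of area \<open>pi a\<close> has radius \<open>sqrt a\<close>.\<close>

lemma disk_of_areaD:
  assumes "disk_of_area (pi * a) D" "0 \<le> a"
  shows "D \<in> sets borel" "emeasure lborel D = ennreal (pi * a)" "\<exists>p. D \<subseteq> cball p (sqrt a)"
proof -
  obtain c r where D: "r > 0" "D = cball c r" "measure lborel D = pi * a"
    using assms unfolding disk_of_area_def by blast
  then show "D \<in> sets borel" by simp
  show "emeasure lborel D = ennreal (pi * a)"
    unfolding D(3)[symmetric] D(2) using emeasure_lborel_cball_finite[of c r]
    by (intro emeasure_eq_ennreal_measure) (auto simp: less_top)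
  have "measure lborel D = pi * r\<^sup>2"
    using D(1) unfolding D(2) by (simp add: content_cball unit_ball_vol_2)
  then have "sqrt a = r" using D(1,3) by (simp add: real_sqrt_unique)
  then show "\<exists>p. D \<subseteq> cball p (sqrt a)" using D by auto
qed

theorem theorem2:
  fixes x :: "nat \<Rightarrow> plane set"
    and G :: "nat \<Rightarrow> segments"
    and L :: "nat \<Rightarrow> real"
  assumes "\<forall>n\<ge>1. finite (x n) \<and> card (x n) = n \<and> x n \<subseteq> square (sqrt (real n))"
    and "\<forall>n\<ge>1. L n > 0"
    and "L \<in> o(\<lambda>n. sqrt (ln (real n)))"
    and "equidistributed L x (\<lambda>n. uniform_on_region (square (sqrt (real n))))
       \<or> (\<exists>\<rho>>0. \<exists>\<epsilon>>0. \<exists>y D.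
            (\<forall>n\<ge>1. y n \<subseteq> x n \<and> disk_of_area (pi * \<rho> * real n) (D n) \<and> y n \<subseteq> D n
                  \<and> real (card (y n)) > pi * \<rho> * real n * \<epsilon>)
            \<and> equidistributed L y (\<lambda>n. uniform_on_region (D n)))"
    and "\<forall>n\<ge>1. network (x n) (G n)"
    and "Bseq (\<lambda>n. network_length (G n) / real n)"
  shows "liminf (\<lambda>n. ereal (excess (x n) (G n) / sqrt (ln (real n)))) > 0"
  using assms(4)
proof (elim disjE exE conjE)
  assume eq: "equidistributed L x (\<lambda>n. uniform_on_region (square (sqrt (real n))))"
  show ?thesis
  proof (rule excess_liminf_pos[OF _ _ assms(3) _ _ _ _ _ _ _ _ eq _ assms(6), where c = 1 and \<alpha> = 1 and \<beta> = 2])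
    fix n :: nat assume "n \<ge> 1"
    show "square (sqrt (real n)) \<in> sets borel" by (simp add: square_eq_cbox)
    show "emeasure lborel (square (sqrt (real n))) = ennreal (1 * real n)" by (simp add: emeasure_square)
    show "\<exists>p. square (sqrt (real n)) \<subseteq> cball p (sqrt (2 * real n))"
      using square_subset_cball[of "real n"] by auto
  qed (use assms(1,2,5) in auto)
next
  fix \<rho> \<epsilon> :: real and y D
  assume \<rho>: "\<rho> > 0" "\<epsilon> > 0" and eq: "equidistributed L y (\<lambda>n. uniform_on_region (D n))"
    and y: "\<forall>n\<ge>1. y n \<subseteq> x n \<and> disk_of_area (pi * \<rho> * real n) (D n) \<and> y n \<subseteq> D n
       \<and> real (card (y n)) > pi * \<rho> * real n * \<epsilon>"
  have disk: "disk_of_area (pi * (\<rho> * real n)) (D n)" if "n \<ge> 1" for n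
    using y that by (simp add: mult.assoc)
  show ?thesis
  proof (rule excess_liminf_pos[OF _ _ assms(3) _ _ _ _ _ _ _ _ eq _ assms(6), where c = "pi * \<rho> * \<epsilon>" and \<alpha> = "pi * \<rho>" and \<beta> = \<rho>])
    fix n :: nat assume n: "n \<ge> 1"
    show "pi * \<rho> * \<epsilon> * real n \<le> real (card (y n))"
      using y n by (simp add: mult_ac less_imp_le)
    show "D n \<in> sets borel" "emeasure lborel (D n) = ennreal (pi * \<rho> * real n)" "\<exists>p. D n \<subseteq> cball p (sqrt (\<rho> * real n))"
      using disk_of_areaD[OF disk[OF n]] \<rho> by (simp_all add: mult.assoc)
  qed (use assms(1,2,5) y \<rho> in auto)
qed

end
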